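(* Let $W$ be a space of quasi-exponentials with the difference data $(\bar\alpha,\bar\mu;\bar z,\bar\lambda)$. Then $\mathfrak{T}_1(W)$ is a space of quasi-exponentials with the difference data $(\bar\alpha,\bar\mu';1-\bar z,\bar\lambda')$, where $1-\bar z=(1-z_1,\dots,1-z_k)$ and $\bar\mu'$, $\bar\lambda'$ are obtained from $\bar\mu$, $\bar\lambda$ by replacing every partition by its conjugate.
   Context: Fix a branch of $\ln$ and put $\alpha^{x}=e^{x\ln\alpha}$ for $\alpha\in\mathbb{C}^*$, $\alpha^{-x}=e^{-x\ln\alpha}$. $(Tf)(x)=f(x+1)$. The discrete Wronskian is $\mathcal{W}(g_1,\dots,g_m)=\det\big((T^{j-1}g_i)_{i,j=1}^m\big)$ (equal to $1$ if $m=0$). A partition is an infinite nonincreasing sequence of nonnegative integers stabilizing at zero; $\mu'$ is the conjugate partition, $\mu'_i=\#\{j:\mu_j\ge i\}$; $|\mu|=\sum_i\mu_i$. Let $\bar\alpha=(\alpha_1,\dots,\alpha_n)$ be pairwise distinct nonzero complex numbers and $\bar\mu=(\mu^{(1)},\dots,\mu^{(n)})$ nonzero partitions; $n_i=(\mu^{(i)})'_1$, $M'=\sum_i(\mu^{(i)})'_1$, $M=\sum_i\mu^{(i)}_1$. $\mathcal{E}(\bar\alpha,\bar\mu)$ is the set of all vector spaces of functions having a basis $\{\alpha_i^xq_{ij}(x):i=1,\dots,n,\ j=1,\dots,n_i\}$ with $q_{ij}$ polynomials, $\deg q_{ij}=n_i+\mu^{(i)}_j-j$ (so $\dim W=M'$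 for $W\in\mathcal{E}(\bar\alpha,\bar\mu)$). Discrete exponents: for $z\in\mathbb{C}$, the sequence of discrete exponents of a finite-dimensional space of quasi-exponentials $W$ (a space spanned by functions $\alpha^xp(x)$ with $\alpha\ne0$ and $p$ a polynomial), $N=\dim W$, at $z$ is the unique sequence of integers $e_1>\dots>e_N$ such that $W$ has a basis $\psi_1,\dots,\psi_N$ with $(T^j\psi_i)(z)=0$ for $j=0,\dots,e_i-1$ and $(T^{e_i}\psi_i)(z)\ne0$. The point $z$ is a discrete singular point of $W$ if this sequence differs from $(N-1,N-2,\dots,0)$. Let $\bar z=(z_1,\dots,z_k)$ be complex numbers with $z_a-z_b\notin\mathbb{Z}$ for $a\ne b$, and $\bar\lambda=(\lambda^{(1)},\dots,\lambda^{(k)})$ partitions. $W\in\mathcal{E}(\bar\alpha,\bar\mu)$ is a space of quasi-exponentials with the difference data $(\bar\alpha,\bar\mu;\bar z,\bar\lambda)$ if $z_1,\dots,z_k$ are discrete singular points of $W$, the sequence of discrete exponents of $W$ at $z_a$ is $e^{(a)}_i=M'+\lambda^{(a)}_i-i$, $i=1,\dots,M'$, with $\lambda^{(a)}_i=0$ for $i>M'$, and $\sum_{a=1}^k|\lambda^{(a)}|=\sum_{i=1}^n|\mu^{(i)}|$. The map $\mathfrak{T}_1$: for $W\in\mathcal{E}(\bar\alpha,\bar\mu)$ let $\widehat W$ be the span of $\alpha_i^xx^p$, $i=1,\dots,n$, $p=0,\dots,\mu^{(i)}_1+n_i-1$, so $W\subset\widehat W$. Choose a basis $f_1,\dots,f_{M'}$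 of $W$ and complete it by $h_1,\dots,h_M$ to a basis of $\widehat W$. $Q(W)$ is the span (independent of the choices) of $$\phi_a=T\left(\frac{\mathcal{W}(f_1,\dots,f_{M'},h_1,\dots,h_{a-1},h_{a+1},\dots,h_M)}{\mathcal{W}(f_1,\dots,f_{M'},h_1,\dots,h_M)}\right),\quad a=1,\dots,M.$$ Then $\mathfrak{T}_1(W)=\{f(-x): f(x)\in Q(W)\}$. *)

theory Defs
  imports
    "HOL-Analysis.Analysis"
    "HOL-Computational_Algebra.Polynomial"
    "HOL-Library.Function_Algebras"
    "Jordan_Normal_Form.Determinant"
begin

text \<open>
  All sequences are indexed from 0: \<open>mu 0\<close> stands for the first part of a partition \<open>mu\<close>,
  and the tuples \<open>alpha\<close>, \<open>mu\<close> (of length \<open>n\<close>) and \<open>z\<close>, \<open>la\<close> (of length \<open>k\<close>) are functions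
  on the naturals of which only the values below the length matter.
\<close>

section \<open>Partitions\<close>

definition is_partition :: "(nat \<Rightarrow> nat) \<Rightarrow> bool" where
  "is_partition mu \<longleftrightarrow> antimono mu \<and> (\<exists>m. \<forall>j\<ge>m. mu j = 0)"

text \<open>\<open>i < mu j\<close> is \<open>mu j \<ge> i + 1\<close>, because position \<open>i\<close> of the conjugate is its part number \<open>i + 1\<close>.\<close>

definition conj_part :: "(nat \<Rightarrow> nat) \<Rightarrow> nat \<Rightarrow> nat" where
  "conj_part mu i = card {j. i < mu j}"

definition part_size :: "(nat \<Rightarrow> nat) \<Rightarrow> nat" where
  "part_size mu = (\<Sum>j | mu j \<noteq> 0. mu j)"

section \<open>The complex vector space of functions\<close>

definition fscale :: "complex \<Rightarrow> (complex \<Rightarrow> complex) \<Rightarrow> complex \<Rightarrow> complex" where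
  "fscale c f = (\<lambda>x. c * f x)"

interpretation cfun: vector_space fscale
  by unfold_locales (auto simp: fscale_def fun_eq_iff algebra_simps)

definition is_basis :: "(complex \<Rightarrow> complex) list \<Rightarrow> (complex \<Rightarrow> complex) set \<Rightarrow> bool" where
  "is_basis fs W \<longleftrightarrow> distinct fs \<and> cfun.independent (set fs) \<and> cfun.span (set fs) = W"

definition shift :: "(complex \<Rightarrow> complex) \<Rightarrow> complex \<Rightarrow> complex" where
  "shift f = (\<lambda>x. f (x + 1))"

definition dwronskian :: "(complex \<Rightarrow> complex) list \<Rightarrow> complex \<Rightarrow> complex" where
  "dwronskian gs x = det (mat (length gs) (length gs) (\<lambda>(i, j). (shift ^^ j) (gs ! i) x))"

section \<open>Quasi-exponentials\<close>

text \<open>A branch is any choice of a logarithm for every nonzero number; no regularity is required.\<close>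

definition is_ln_branch :: "(complex \<Rightarrow> complex) \<Rightarrow> bool" where
  "is_ln_branch L \<longleftrightarrow> (\<forall>w. w \<noteq> 0 \<longrightarrow> exp (L w) = w)"

definition cpow :: "(complex \<Rightarrow> complex) \<Rightarrow> complex \<Rightarrow> complex \<Rightarrow> complex" where
  "cpow L w x = exp (x * L w)"

definition qe_spaces ::
  "(complex \<Rightarrow> complex) \<Rightarrow> nat \<Rightarrow> (nat \<Rightarrow> complex) \<Rightarrow> (nat \<Rightarrow> nat \<Rightarrow> nat) \<Rightarrow> (complex \<Rightarrow> complex) set set"
where
  "qe_spaces L n alpha mu = {W. \<exists>q :: nat \<Rightarrow> nat \<Rightarrow> complex poly.
     (\<forall>i<n. \<forall>j < conj_part (mu i) 0.
        degree (q i j) = conj_part (mu i) 0 + mu i j - Suc j) \<and>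
     is_basis [\<lambda>x. cpow L (alpha i) x * poly (q i j) x. i \<leftarrow> [0..<n], j \<leftarrow> [0..<conj_part (mu i) 0]] W}"

section \<open>Discrete exponents\<close>

text \<open>
  The exponents are naturals, since only nonnegative powers of the shift are involved. The list
  \<open>es\<close> is determined by \<open>W\<close> and \<open>z\<close>.
\<close>

definition has_discrete_exponents :: "(complex \<Rightarrow> complex) set \<Rightarrow> complex \<Rightarrow> nat list \<Rightarrow> bool" where
  "has_discrete_exponents W z es \<longleftrightarrow> sorted_wrt (>) es \<and>
     (\<exists>psi. is_basis psi W \<and> length psi = length es \<and>
        (\<forall>i < length es. (\<forall>j < es ! i. (shift ^^ j) (psi ! i) z = 0) \<and>
                         (shift ^^ (es ! i)) (psi ! i) z \<noteq> 0))"

definition discrete_singular_point :: "(complex \<Rightarrow> complex) set \<Rightarrow> complex \<Rightarrow> bool" where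
  "discrete_singular_point W z \<longleftrightarrow>
     (\<exists>es. has_discrete_exponents W z es \<and> es \<noteq> rev [0..<cfun.dim W])"

section \<open>Difference data\<close>

definition admissible_data ::
  "nat \<Rightarrow> (nat \<Rightarrow> complex) \<Rightarrow> (nat \<Rightarrow> nat \<Rightarrow> nat) \<Rightarrow> nat \<Rightarrow> (nat \<Rightarrow> complex) \<Rightarrow> (nat \<Rightarrow> nat \<Rightarrow> nat) \<Rightarrow> bool"
where
  "admissible_data n alpha mu k z la \<longleftrightarrow>
     inj_on alpha {..<n} \<and> (\<forall>i<n. alpha i \<noteq> 0) \<and>
     (\<forall>i<n. is_partition (mu i) \<and> (\<exists>j. mu i j \<noteq> 0)) \<and>
     (\<forall>a<k. \<forall>b<k. a \<noteq> b \<longrightarrow> z a - z b \<notin> \<int>) \<and>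
     (\<forall>a<k. is_partition (la a))"

definition has_difference_data ::
  "(complex \<Rightarrow> complex) \<Rightarrow> nat \<Rightarrow> (nat \<Rightarrow> complex) \<Rightarrow> (nat \<Rightarrow> nat \<Rightarrow> nat) \<Rightarrow>
   nat \<Rightarrow> (nat \<Rightarrow> complex) \<Rightarrow> (nat \<Rightarrow> nat \<Rightarrow> nat) \<Rightarrow> (complex \<Rightarrow> complex) set \<Rightarrow> bool"
where
  "has_difference_data L n alpha mu k z la W \<longleftrightarrow>
     admissible_data n alpha mu k z la \<and>
     W \<in> qe_spaces L n alpha mu \<and>
     (let M' = (\<Sum>i<n. conj_part (mu i) 0) in
        \<forall>a<k. discrete_singular_point W (z a) \<and>
              has_discrete_exponents W (z a) (map (\<lambda>i. M' + la a i - Suc i) [0..<M']) \<and>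
              (\<forall>i\<ge>M'. la a i = 0)) \<and>
     (\<Sum>a<k. part_size (la a)) = (\<Sum>i<n. part_size (mu i))"

section \<open>The duality map\<close>

definition W_hat ::
  "(complex \<Rightarrow> complex) \<Rightarrow> nat \<Rightarrow> (nat \<Rightarrow> complex) \<Rightarrow> (nat \<Rightarrow> nat \<Rightarrow> nat) \<Rightarrow> (complex \<Rightarrow> complex) set"
where
  "W_hat L n alpha mu =
     cfun.span {\<lambda>x. cpow L (alpha i) x * x ^ p | i p. i < n \<and> p < mu i 0 + conj_part (mu i) 0}"

definition phi_fun ::
  "(complex \<Rightarrow> complex) list \<Rightarrow> (complex \<Rightarrow> complex) list \<Rightarrow> nat \<Rightarrow> complex \<Rightarrow> complex"
where
  "phi_fun fs hs a =
     shift (\<lambda>x. dwronskian (fs @ take a hs @ drop (Suc a) hs) x / dwronskian (fs @ hs) x)"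

text \<open>
  The description picks the one space which arises from all choices of \<open>fs\<close> and \<open>hs\<close>; it is
  meaningful because the span does not depend on these choices.
\<close>

definition Q_space ::
  "(complex \<Rightarrow> complex) \<Rightarrow> nat \<Rightarrow> (nat \<Rightarrow> complex) \<Rightarrow> (nat \<Rightarrow> nat \<Rightarrow> nat) \<Rightarrow>
   (complex \<Rightarrow> complex) set \<Rightarrow> (complex \<Rightarrow> complex) set"
where
  "Q_space L n alpha mu W =
     (THE V. \<exists>fs hs. is_basis fs W \<and> is_basis (fs @ hs) (W_hat L n alpha mu) \<and>
                     V = cfun.span (phi_fun fs hs ` {..<length hs}))"

definition frakT1 ::
  "(complex \<Rightarrow> complex) \<Rightarrow> nat \<Rightarrow> (nat \<Rightarrow> complex) \<Rightarrow> (nat \<Rightarrow> nat \<Rightarrow> nat) \<Rightarrow>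
   (complex \<Rightarrow> complex) set \<Rightarrow> (complex \<Rightarrow> complex) set"
where
  "frakT1 L n alpha mu W = (\<lambda>f x. f (- x)) ` Q_space L n alpha mu W"

end

theory Submission imports Defs begin

text \<open>
  The space \<open>H\<close> spanned by \<open>\<alpha>\<^sub>i\<^sup>x x\<^sup>p\<close>, \<open>p < d\<^sub>i\<close>, has dimension \<open>D = \<Sum>d\<^sub>i\<close>, is invariant under
  translation, and a function in it which vanishes at \<open>x, x + 1, \<dots>, x + D - 1\<close> is zero. Hence there is a
  unique \<open>k \<in> H\<close> with \<open>k(j) = 0\<close> for \<open>0 \<le> j < D - 1\<close> and \<open>k(D - 1) = 1\<close>, and for every basis \<open>u\<close> of
  \<open>H\<close> one can write \<open>k(y - x) = \<Sum>\<^sub>a v\<^sub>a(x) u\<^sub>a(y)\<close>. By Cramer's rule the \<open>v\<^sub>a\<close> are, up to sign, the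
  quotients of Wronskians defining \<open>Q(W)\<close>, so \<open>Q(W)\<close> is the space of functions \<open>x \<mapsto> \<phi>(k(\<cdot> - x - 1))\<close>
  for the linear functionals \<open>\<phi>\<close> on \<open>H\<close> that vanish on \<open>W\<close>. In particular \<open>Q(W)\<close> may be computed
  from any basis of \<open>H\<close> that extends one of \<open>W\<close>. With a basis of quasi-exponentials, comparing
  coefficients in \<open>y\<close> gives the degrees of the polynomials in \<open>v\<^sub>a\<close>; with a basis having distinct
  vanishing orders \<open>e\<^sub>a\<close> at \<open>z\<close>, the reflected \<open>v\<^sub>a\<close> has vanishing order \<open>D - 1 - e\<^sub>a\<close> at \<open>1 - z\<close>. Both times
  the complement in \<open>{0, \<dots>, D - 1}\<close> is described by the conjugate partition.
\<close>

hide_const (open) Module.smult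

section \<open>Partitions\<close>

lemma is_partition_finite:
  assumes "is_partition mu"
  shows "finite {j. i < mu j}"
proof -
  obtain m where "\<forall>j\<ge>m. mu j = 0" using assms by (auto simp: is_partition_def)
  then have "{j. i < mu j} \<subseteq> {..<m}" by (auto simp: not_less[symmetric])
  then show ?thesis using finite_subset by blast
qed

text \<open>Since \<open>mu\<close> is nonincreasing, \<open>{j. i < mu j}\<close> is an initial
  segment of the naturals, and its cardinality is its endpoint. The facts on conjugates below rest
  on this equivalence.\<close>

lemma less_conj_part_iff:
  assumes "is_partition mu"
  shows "j < conj_part mu i \<longleftrightarrow> i < mu j"
proof -
  have mono: "mu b \<le> mu a" if "a \<le> b" for a b
    using assms that by (auto simp: is_partition_def antimono_def)
  have fin: "finite {j. i < mu j}" by (rule is_partition_finite[OF assms])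
  have "\<exists>m. {j. i < mu j} = {..<m}"
  proof (cases "{j. i < mu j} = {}")
    case False
    have "{j. i < mu j} = {..<Suc (Max {j. i < mu j})}"
    proof (intro equalityI subsetI)
      fix a assume "a \<in> {j. i < mu j}"
      then show "a \<in> {..<Suc (Max {j. i < mu j})}" using Max_ge[OF fin] by (auto simp: less_Suc_eq_le)
    next
      fix a assume "a \<in> {..<Suc (Max {j. i < mu j})}"
      moreover have "i < mu (Max {j. i < mu j})" using Max_in[OF fin False] by auto
      ultimately show "a \<in> {j. i < mu j}" using mono[of a "Max {j. i < mu j}"] by auto
    qed
    then show ?thesis by blast
  qed auto
  then obtain m where m: "{j. i < mu j} = {..<m}" by blast
  then have "conj_part mu i = m" by (simp add: conj_part_def)
  with m show ?thesis by blast
qed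

lemma is_partition_conj_part:
  assumes "is_partition mu"
  shows "is_partition (conj_part mu)"
  unfolding is_partition_def
proof
  have "i < conj_part mu a" if "a \<le> b" "i < conj_part mu b" for i a b
    using that less_conj_part_iff[OF assms] by auto
  then show "antimono (conj_part mu)" unfolding antimono_def by (meson not_le_imp_less nat_less_le less_irrefl)
  have "conj_part mu j = 0" if "j \<ge> mu 0" for j
    using less_conj_part_iff[OF assms, of 0 j] that by auto
  then show "\<exists>m. \<forall>j\<ge>m. conj_part mu j = 0" by blast
qed

lemma conj_part_conj_part:
  assumes "is_partition mu"
  shows "conj_part (conj_part mu) = mu"
proof
  fix i
  have "a < conj_part (conj_part mu) i \<longleftrightarrow> a < mu i" for a
    using less_conj_part_iff[OF is_partition_conj_part[OF assms], of a i]
      less_conj_part_iff[OF assms, of i a] by simp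
  then show "conj_part (conj_part mu) i = mu i" by (meson less_irrefl nat_neq_iff)
qed

text \<open>Both sizes count the cells of the Young diagram, which conjugation transposes.\<close>

lemma part_size_conj_part:
  assumes "is_partition mu"
  shows "part_size (conj_part mu) = part_size mu"
proof -
  have size: "part_size nu = card {(a, b). b < nu a}" if nu: "is_partition nu" for nu
  proof -
    have "{(a, b). b < nu a} = (SIGMA a:{j. nu j \<noteq> 0}. {..<nu a})" by auto
    moreover have "finite {j. nu j \<noteq> 0}" using is_partition_finite[OF nu, of 0] by simp
    ultimately show ?thesis by (simp add: part_size_def)
  qed
  have "{(a, b). b < conj_part mu a} = prod.swap ` {(a, b). b < mu a}"
    by (auto simp: less_conj_part_iff[OF assms] image_iff)
  then show ?thesis
    by (simp add: size assms is_partition_conj_part card_image)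
qed

text \<open>
  Reading the boundary of a partition inside an \<open>N\<close> by \<open>M\<close> rectangle: the first \<open>N\<close> values are
  the vertical steps, the last \<open>M\<close> values the horizontal ones.
\<close>

definition boundary_pos :: "nat \<Rightarrow> (nat \<Rightarrow> nat) \<Rightarrow> nat \<Rightarrow> nat" where
  "boundary_pos N mu a =
     (if a < N then N + mu a - Suc a else N + (a - N) - conj_part mu (a - N))"

lemma conj_part_le_iff:
  assumes "is_partition mu"
  shows "conj_part mu i \<le> j \<longleftrightarrow> mu j \<le> i"
  using less_conj_part_iff[OF assms, of j i] by linarith

text \<open>Vertical positions strictly decrease and horizontal ones strictly increase. A vertical
  step \<open>a\<close> never meets a horizontal step \<open>j\<close>: it lies strictly below if
  \<open>mu a \<le> j\<close> and strictly above otherwise. An injection of a finite set into itself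
  is onto.\<close>

lemma bij_betw_boundary_pos:
  assumes mu: "is_partition mu" and N: "mu N = 0" and M: "mu 0 \<le> M"
  shows "bij_betw (boundary_pos N mu) {..<N + M} {..<N + M}"
proof -
  have mono: "mu b \<le> mu a" if "a \<le> b" for a b
    using mu that by (auto simp: is_partition_def antimono_def)
  have mono': "conj_part mu b \<le> conj_part mu a" if "a \<le> b" for a b
    using is_partition_conj_part[OF mu] that by (auto simp: is_partition_def antimono_def)
  have le: "conj_part mu j \<le> N" for j using conj_part_le_iff[OF mu] N by simp
  have neq: "N + mu a - Suc a \<noteq> N + j - conj_part mu j" if "a < N" for a j
    using conj_part_le_iff[OF mu, of j a] le[of j] that by linarith
  have inj1: "a = b" if "a < N" "b < N" "N + mu a - Suc a = N + mu b - Suc b" for a b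
    using that mono[of a b] mono[of b a] by linarith
  have inj2: "a = b" if "N + a - conj_part mu a = N + b - conj_part mu b" for a b
    using that mono'[of a b] mono'[of b a] le[of a] le[of b] by linarith
  have "inj_on (boundary_pos N mu) {..<N + M}"
  proof (rule inj_onI)
    fix a b assume ab: "boundary_pos N mu a = boundary_pos N mu b"
    consider "a < N" "b < N" | "a < N" "\<not> b < N" | "\<not> a < N" "b < N" | "\<not> a < N" "\<not> b < N"
      by blast
    then show "a = b"
    proof cases
      case 1
      show ?thesis by (rule inj1) (use 1 ab in \<open>simp_all add: boundary_pos_def\<close>)
    next
      case 2
      with neq[of a "b - N"] ab show ?thesis by (simp add: boundary_pos_def)
    next
      case 3
      with neq[of b "a - N"] ab show ?thesis by (simp add: boundary_pos_def)
    next
      case 4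
      then have "a - N = b - N" using ab by - (rule inj2, simp add: boundary_pos_def)
      with 4 show ?thesis by simp
    qed
  qed
  moreover have "boundary_pos N mu ` {..<N + M} \<subseteq> {..<N + M}"
  proof (rule image_subsetI)
    fix a assume "a \<in> {..<N + M}"
    then show "boundary_pos N mu a \<in> {..<N + M}"
      using M mono[of 0 a] by (auto simp: boundary_pos_def)
  qed
  ultimately show ?thesis
    by (simp add: bij_betw_def endo_inj_surj)
qed

text \<open>Reversing the interval \<open>{..<N + M}\<close> turns the horizontal steps into the
  vertical steps of the conjugate partition. Both the degrees and the exponents of the dual space
  come from this identity.\<close>

lemma boundary_pos_dual:
  assumes mu: "is_partition mu" and N: "mu N = 0" and M: "mu 0 \<le> M" and j: "j < M"
  shows "N + M - Suc (boundary_pos N mu (N + j)) = M + conj_part mu j - Suc j"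
proof -
  have "conj_part mu j \<le> N" using conj_part_le_iff[OF mu] N by simp
  then show ?thesis using j by (simp add: boundary_pos_def)
qed

section \<open>Finite families of functions\<close>

lemma cfun_sum_apply:
  fixes u :: "'i \<Rightarrow> complex \<Rightarrow> complex"
  shows "(\<Sum>a\<in>I. u a) = (\<lambda>x. \<Sum>a\<in>I. u a x)"
  by (induction I rule: infinite_finite_induct) (auto simp: fun_eq_iff)

definition lincomb :: "('i \<Rightarrow> complex) \<Rightarrow> ('i \<Rightarrow> complex \<Rightarrow> complex) \<Rightarrow> 'i set \<Rightarrow> complex \<Rightarrow> complex" where
  "lincomb c u I = (\<lambda>x. \<Sum>a\<in>I. c a * u a x)"

lemma lincomb_eq_sum: "lincomb c u I = (\<Sum>a\<in>I. fscale (c a) (u a))"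
  by (simp add: lincomb_def cfun_sum_apply fscale_def)

lemma span_family:
  assumes "finite I"
  shows "cfun.span (u ` I) = range (\<lambda>c. lincomb c u I)"
proof
  have "cfun.subspace (range (\<lambda>c. lincomb c u I))"
  proof (rule cfun.subspaceI)
    show "0 \<in> range (\<lambda>c. lincomb c u I)"
      by (rule range_eqI[where x = "\<lambda>_. 0"]) (simp add: lincomb_def fun_eq_iff)
  next
    fix f g assume "f \<in> range (\<lambda>c. lincomb c u I)" "g \<in> range (\<lambda>c. lincomb c u I)"
    then obtain c d where "f = lincomb c u I" "g = lincomb d u I" by blast
    then have "f + g = lincomb (\<lambda>a. c a + d a) u I"
      by (simp add: lincomb_def fun_eq_iff algebra_simps sum.distrib)
    then show "f + g \<in> range (\<lambda>c. lincomb c u I)" by blast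
  next
    fix s f assume "f \<in> range (\<lambda>c. lincomb c u I)"
    then obtain c where "f = lincomb c u I" by blast
    then have "fscale s f = lincomb (\<lambda>a. s * c a) u I"
      by (simp add: lincomb_def fun_eq_iff fscale_def sum_distrib_left algebra_simps)
    then show "fscale s f \<in> range (\<lambda>c. lincomb c u I)" by blast
  qed
  moreover have "u a \<in> range (\<lambda>c. lincomb c u I)" if "a \<in> I" for a
    using assms that
    by (intro range_eqI[where x = "\<lambda>b. if b = a then 1 else 0"])
      (simp add: lincomb_def fun_eq_iff if_distrib[of "\<lambda>c. c * _"] sum.delta cong: if_cong)
  ultimately show "cfun.span (u ` I) \<subseteq> range (\<lambda>c. lincomb c u I)"
    by (intro cfun.span_minimal) auto
  show "range (\<lambda>c. lincomb c u I) \<subseteq> cfun.span (u ` I)"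
    unfolding lincomb_eq_sum
    by (intro image_subsetI cfun.span_sum cfun.span_scale cfun.span_base) blast
qed

text \<open>Families replace sets here, so that coefficients attach to indices and a repeated
  function counts as a dependence.\<close>

definition indep_fam :: "('i \<Rightarrow> complex \<Rightarrow> complex) \<Rightarrow> 'i set \<Rightarrow> bool" where
  "indep_fam u I \<longleftrightarrow> (\<forall>c. lincomb c u I = (\<lambda>_. 0) \<longrightarrow> (\<forall>a\<in>I. c a = 0))"

lemma indep_famD: "indep_fam u I \<Longrightarrow> lincomb c u I = (\<lambda>_. 0) \<Longrightarrow> a \<in> I \<Longrightarrow> c a = 0"
  by (auto simp: indep_fam_def)

lemma indep_fam_iff:
  assumes "finite I"
  shows "indep_fam u I \<longleftrightarrow> inj_on u I \<and> cfun.independent (u ` I)"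
proof
  assume ind: "indep_fam u I"
  have inj: "inj_on u I"
  proof (rule inj_onI, rule ccontr)
    fix a b assume ab: "a \<in> I" "b \<in> I" "u a = u b" "a \<noteq> b"
    \<comment> \<open>Equal members would give the relation \<open>u a - u b = 0\<close>, whose
      coefficient at \<open>a\<close> is 1.\<close>
    have "(if a = a then 1 else if a = b then - 1 else 0) = (0 :: complex)"
    proof (rule indep_famD[OF ind _ ab(1), where c = "\<lambda>c. if c = a then 1 else if c = b then - 1 else 0"])
      have *: "(if c = a then 1 else if c = b then - 1 else 0) * u c x =
          (if c = a then u a x else 0) - (if c = b then u b x else 0)" for c x
        using ab by auto
      show "lincomb (\<lambda>c. if c = a then 1 else if c = b then - 1 else 0) u I = (\<lambda>_. 0)"
        using assms ab unfolding lincomb_def * by (simp add: sum_subtractf)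
    qed
    then show False by simp
  qed
  moreover have "cfun.independent (u ` I)"
  proof
    assume "cfun.dependent (u ` I)"
    then obtain c where c: "\<exists>v\<in>u ` I. c v \<noteq> 0" "(\<Sum>v\<in>u ` I. fscale (c v) v) = 0"
      using cfun.dependent_finite[of "u ` I"] assms by auto
    have "lincomb (c \<circ> u) u I = (\<lambda>_. 0)"
      using c(2) sum.reindex[OF inj, of "\<lambda>v. fscale (c v) v"]
      by (simp add: lincomb_eq_sum zero_fun_def)
    then have "(c \<circ> u) a = 0" if "a \<in> I" for a by (rule indep_famD[OF ind _ that])
    then show False using c(1) by auto
  qed
  ultimately show "inj_on u I \<and> cfun.independent (u ` I)" ..
next
  assume A: "inj_on u I \<and> cfun.independent (u ` I)"
  show "indep_fam u I"
    unfolding indep_fam_def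
  proof (intro allI impI ballI)
    fix c a assume c: "lincomb c u I = (\<lambda>_. 0)" and a: "a \<in> I"
    have "(\<Sum>v\<in>u ` I. fscale (c (the_inv_into I u v)) v) = 0"
      using c A by (subst sum.reindex) (auto simp: lincomb_eq_sum zero_fun_def the_inv_into_f_f)
    moreover have "u a \<in> u ` I" using a by simp
    ultimately have "c (the_inv_into I u (u a)) = 0"
      using cfun.independentD[of "u ` I" "u ` I" "\<lambda>v. c (the_inv_into I u v)" "u a"] A assms
      by simp
    then show "c a = 0" using A a by (simp add: the_inv_into_f_f)
  qed
qed

lemma is_basis_map:
  assumes "distinct xs"
  shows "is_basis (map u xs) W \<longleftrightarrow> indep_fam u (set xs) \<and> cfun.span (u ` set xs) = W"
  using assms by (auto simp: is_basis_def distinct_map indep_fam_iff)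

lemma is_basis_nth:
  "is_basis us W \<longleftrightarrow>
     indep_fam ((!) us) {..<length us} \<and> cfun.span ((!) us ` {..<length us}) = W"
  using is_basis_map[of "[0..<length us]" "(!) us" W] by (simp add: map_nth atLeast0LessThan)

lemma card_le_of_indep_fam:
  assumes "finite I" "finite J" "indep_fam u I" "u ` I \<subseteq> cfun.span (w ` J)"
  shows "card I \<le> card J"
proof -
  have "card (u ` I) \<le> card (w ` J)"
    using assms by (intro cfun.independent_span_bound[THEN conjunct2]) (auto simp: indep_fam_iff)
  moreover have "card (u ` I) = card I" using assms by (simp add: indep_fam_iff card_image)
  ultimately show ?thesis using card_image_le[OF assms(2), of w] by linarith
qed

text \<open>A vector of the larger span outside the smaller one would extend \<open>u\<close> to an
  independent set with more elements than the spanning family \<open>w\<close> permits.\<close>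

lemma span_eq_of_card:
  assumes "finite I" "finite J" "indep_fam u I" "u ` I \<subseteq> cfun.span (w ` J)" "card J \<le> card I"
  shows "cfun.span (u ` I) = cfun.span (w ` J)"
proof
  show "cfun.span (u ` I) \<subseteq> cfun.span (w ` J)"
    using assms(4) by (intro cfun.span_minimal) auto
  show "cfun.span (w ` J) \<subseteq> cfun.span (u ` I)"
  proof (rule ccontr)
    assume "\<not> ?thesis"
    then obtain v where v: "v \<in> cfun.span (w ` J)" "v \<notin> cfun.span (u ` I)" by blast
    have ind: "inj_on u I" "cfun.independent (u ` I)" using assms by (auto simp: indep_fam_iff)
    have "cfun.independent (insert v (u ` I))"
      by (rule cfun.independent_insertI[OF v(2) ind(2)])
    moreover have "insert v (u ` I) \<subseteq> cfun.span (w ` J)" using v(1) assms(4) by blast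
    ultimately have "card (insert v (u ` I)) \<le> card (w ` J)"
      using cfun.independent_span_bound[of "w ` J"] assms(2) by blast
    moreover have "v \<notin> u ` I" using v(2) cfun.span_base[of v "u ` I"] by argo
    then have "card (insert v (u ` I)) = Suc (card I)"
      using assms(1) ind by (simp add: card_image)
    ultimately show False using card_image_le[OF assms(2), of w] assms(5) by linarith
  qed
qed

text \<open>An independent family extends to a basis of the space of all functions, so the values of
  a functional on it are free.\<close>

lemma linear_functional_exists:
  assumes "finite I" "indep_fam u I"
  shows "\<exists>\<phi>. Vector_Spaces.linear fscale (*) \<phi> \<and> (\<forall>a\<in>I. \<phi> (u a) = b a)"
proof -
  interpret P: vector_space_pair fscale "(*) :: complex \<Rightarrow> complex \<Rightarrow> complex"
    by unfold_locales (auto simp: algebra_simps)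
  have ind: "inj_on u I" "cfun.independent (u ` I)" using assms by (auto simp: indep_fam_iff)
  obtain \<phi> where "Vector_Spaces.linear fscale (*) \<phi>" "\<forall>v\<in>u ` I. \<phi> v = b (the_inv_into I u v)"
    using P.linear_independent_extend[OF ind(2), of "\<lambda>v. b (the_inv_into I u v)"] by blast
  then show ?thesis using ind(1) by (auto simp: the_inv_into_f_f)
qed

lemma linear_lincomb:
  assumes "Vector_Spaces.linear fscale (*) \<phi>"
  shows "\<phi> (lincomb c u I) = (\<Sum>a\<in>I. c a * \<phi> (u a))"
proof -
  interpret P: Vector_Spaces.linear fscale "(*) :: complex \<Rightarrow> complex \<Rightarrow> complex" \<phi> by fact
  show ?thesis by (simp add: lincomb_eq_sum P.sum P.scale)
qed

section \<open>Quasi-exponentials\<close>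

text \<open>The zero polynomial has \<open>degree\<close> 0, so \<open>degree p < d\<close> could
  not express \<open>p = 0\<close> at \<open>d = 0\<close>. The condition on coefficients does, and
  it is stable under differences and scaling.\<close>

definition deg_below :: "nat \<Rightarrow> 'a::zero poly \<Rightarrow> bool" where
  "deg_below d p \<longleftrightarrow> (\<forall>m\<ge>d. coeff p m = 0)"

lemma deg_below_degree: "degree p < d \<Longrightarrow> deg_below d p"
  by (simp add: deg_below_def coeff_eq_0)

lemma deg_below_Suc_degree: "deg_below (Suc (degree p)) p"
  by (simp add: deg_below_degree)

lemma deg_below_imp_degree_less: "deg_below d p \<Longrightarrow> p \<noteq> 0 \<Longrightarrow> degree p < d"
  unfolding deg_below_def by (meson leading_coeff_0_iff not_less)

lemma deg_below_iff: "deg_below d p \<longleftrightarrow> p = 0 \<or> degree p < d"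
  using deg_below_degree[of p d] deg_below_imp_degree_less[of d p] by (auto simp: deg_below_def)

lemma deg_below_translate:
  fixes p :: "complex poly"
  assumes "deg_below d p"
  shows "deg_below d (p \<circ>\<^sub>p [:a, 1:])"
  using assms by (auto simp: deg_below_iff degree_pcompose)

lemma deg_below_smult: "deg_below d p \<Longrightarrow> deg_below d (smult (c :: complex) p)"
  by (simp add: deg_below_def)

lemma deg_below_diff: "deg_below d p \<Longrightarrow> deg_below d q \<Longrightarrow> deg_below d (p - q :: complex poly)"
  by (simp add: deg_below_def)

lemma lead_coeff_translate:
  fixes p :: "complex poly"
  shows "coeff (p \<circ>\<^sub>p [:a, 1:]) (degree p) = lead_coeff p"
  using lead_coeff_comp[of "[:a, 1:]" p] by (simp add: degree_pcompose)

text \<open>Translation keeps the leading coefficient, so the top terms cancel.\<close>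

lemma deg_below_difference:
  fixes p :: "complex poly"
  assumes "deg_below (Suc d) p"
  shows "deg_below d (p \<circ>\<^sub>p [:1, 1:] - p)"
  unfolding deg_below_def
proof (intro allI impI)
  fix m assume m: "m \<ge> d"
  consider "degree p < m" | "degree p = m" | "m < degree p" by linarith
  then show "coeff (p \<circ>\<^sub>p [:1, 1:] - p) m = 0"
  proof cases
    case 1
    then show ?thesis by (simp add: coeff_eq_0 degree_pcompose)
  next
    case 2
    then show ?thesis using lead_coeff_translate[of p 1] by simp
  next
    case 3
    then have "p = 0" using assms m by (auto simp: deg_below_iff)
    then show ?thesis by simp
  qed
qed

lemma poly_eq_0_if_zero_on_nat:
  fixes p :: "complex poly"
  assumes "\<And>m :: nat. poly p (of_nat m) = 0"
  shows "p = 0"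
proof (rule ccontr)
  assume "p \<noteq> 0"
  then have "finite {x. poly p x = 0}" by (rule poly_roots_finite)
  moreover have "range (of_nat :: nat \<Rightarrow> complex) \<subseteq> {x. poly p x = 0}" using assms by auto
  ultimately have "finite (range (of_nat :: nat \<Rightarrow> complex))" by (rule finite_subset[rotated])
  moreover have "inj (of_nat :: nat \<Rightarrow> complex)" by (simp add: inj_on_def)
  ultimately show False using finite_imageD infinite_UNIV_nat by blast
qed

text \<open>
  Applying \<open>T - \<alpha>\<^sub>i\<close> lowers the degree of the \<open>i\<close>-th polynomial by one and does not raise the
  others, at the price of one evaluation point.
\<close>

lemma quasi_exponential_eq_0:
  fixes alpha :: "nat \<Rightarrow> complex" and p :: "nat \<Rightarrow> complex poly"
  assumes inj: "inj_on alpha {..<n}" and nz: "\<And>i. i < n \<Longrightarrow> alpha i \<noteq> 0"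
    and deg: "\<And>i. i < n \<Longrightarrow> deg_below (d i) (p i)"
    and zero: "\<And>m. m < (\<Sum>i<n. d i) \<Longrightarrow> (\<Sum>i<n. alpha i ^ m * poly (p i) (of_nat m)) = 0"
    and i: "i < n"
  shows "p i = 0"
  using deg zero i
proof (induction "\<Sum>i<n. d i" arbitrary: d p i)
  case 0
  then have "d i = 0" by simp
  then show ?case using 0(2)[OF 0(4)] by (simp add: deg_below_iff)
next
  case (Suc D)
  obtain i0 where i0: "i0 < n" "d i0 \<noteq> 0"
    using Suc.hyps(2) by (metis lessThan_iff nat.distinct(1) sum.neutral)
  define d' where "d' = d(i0 := d i0 - 1)"
  \<comment> \<open>These are the polynomials of \<open>(T - alpha i0) f\<close>, where
    \<open>f\<close> is the quasi-exponential with polynomials \<open>p\<close>.\<close>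
  define q where "q i = smult (alpha i) (p i \<circ>\<^sub>p [:1, 1:]) - smult (alpha i0) (p i)" for i
  have sum': "(\<Sum>i<n. d' i) = D"
  proof -
    have "(\<Sum>i<n. d i) = d i0 + (\<Sum>i\<in>{..<n} - {i0}. d i)"
      using i0(1) by (intro sum.remove) auto
    moreover have "(\<Sum>i<n. d' i) = d' i0 + (\<Sum>i\<in>{..<n} - {i0}. d' i)"
      using i0(1) by (intro sum.remove) auto
    moreover have "(\<Sum>i\<in>{..<n} - {i0}. d' i) = (\<Sum>i\<in>{..<n} - {i0}. d i)"
      by (rule sum.cong) (auto simp: d'_def)
    ultimately show ?thesis using Suc.hyps(2) i0(2) by (simp add: d'_def)
  qed
  have q0: "q i = 0" if "i < n" for i
  proof (rule Suc.hyps(1)[of d' q])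
    show "D = (\<Sum>i<n. d' i)" using sum' by simp
  next
    fix j assume j: "j < n"
    show "deg_below (d' j) (q j)"
    proof (cases "j = i0")
      case True
      have "q j = smult (alpha i0) (p i0 \<circ>\<^sub>p [:1, 1:] - p i0)"
        by (simp add: q_def True smult_diff_right)
      moreover have "deg_below (Suc (d' i0)) (p i0)" using Suc.prems(1)[OF i0(1)] i0(2) by (simp add: d'_def)
      ultimately show ?thesis by (simp add: True deg_below_smult deg_below_difference)
    next
      case False
      then show ?thesis using Suc.prems(1)[OF j]
        by (simp add: d'_def q_def deg_below_diff deg_below_smult deg_below_translate)
    qed
  next
    fix m assume "m < (\<Sum>i<n. d' i)"
    then have m: "m < (\<Sum>i<n. d i)" "Suc m < (\<Sum>i<n. d i)" using sum' Suc.hyps(2) by auto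
    have "(\<Sum>j<n. alpha j ^ m * poly (q j) (of_nat m)) =
        (\<Sum>j<n. alpha j ^ Suc m * poly (p j) (of_nat (Suc m))) -
        alpha i0 * (\<Sum>j<n. alpha j ^ m * poly (p j) (of_nat m))"
      by (simp add: q_def poly_pcompose sum_subtractf sum_distrib_left algebra_simps)
    also have "\<dots> = 0" using Suc.prems(2)[OF m(1)] Suc.prems(2)[OF m(2)] by simp
    finally show "(\<Sum>j<n. alpha j ^ m * poly (q j) (of_nat m)) = 0" .
  qed (rule that)
  \<comment> \<open>Away from \<open>i0\<close> the leading coefficient of \<open>p j\<close>
    survives in \<open>q j\<close> with the nonzero factor
    \<open>alpha j - alpha i0\<close>.\<close>
  have other: "p j = 0" if j: "j < n" "j \<noteq> i0" for j
  proof -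
    have "coeff (q j) (degree (p j)) = (alpha j - alpha i0) * lead_coeff (p j)"
      by (simp add: q_def lead_coeff_translate algebra_simps)
    moreover have "alpha j \<noteq> alpha i0" using inj j i0(1) by (auto dest: inj_onD)
    ultimately show ?thesis using q0[OF j(1)] by simp
  qed
  \<comment> \<open>The equation \<open>q i0 = 0\<close> makes \<open>p i0\<close> invariant under
    unit steps; its value at 0 is the whole sum at \<open>m = 0\<close>, because the other
    polynomials vanish.\<close>
  have "poly (p i0) (of_nat m) = 0" for m
  proof (induction m)
    case 0
    have "0 = (\<Sum>j<n. alpha j ^ 0 * poly (p j) (of_nat 0))"
      using Suc.prems(2)[of 0] Suc.hyps(2) by simp
    also have "\<dots> = (\<Sum>j<n. if j = i0 then poly (p i0) 0 else 0)"
      by (rule sum.cong) (auto simp: other)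
    finally show ?case using i0(1) by simp
  next
    case (Suc m)
    have "poly (q i0) (of_nat m) = 0" using q0[OF i0(1)] by simp
    then show ?case using Suc nz[OF i0(1)] by (simp add: q_def poly_pcompose algebra_simps)
  qed
  then have "p i0 = 0" by (rule poly_eq_0_if_zero_on_nat)
  then show ?case using other Suc.prems(3) by blast
qed

text \<open>Among the terms with nonzero coefficient, the one of largest degree has a leading term
  that nothing can cancel.\<close>

lemma poly_lin_indep_degree:
  fixes p :: "'i \<Rightarrow> complex poly"
  assumes fin: "finite A" and inj: "inj_on (\<lambda>a. degree (p a)) A" and nz: "\<And>a. a \<in> A \<Longrightarrow> p a \<noteq> 0"
    and sum0: "(\<Sum>a\<in>A. smult (c a) (p a)) = 0" and a: "a \<in> A"
  shows "c a = 0"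
proof (rule ccontr)
  assume "c a \<noteq> 0"
  define B where "B = {a \<in> A. c a \<noteq> 0}"
  have B: "finite B" "B \<noteq> {}" using fin a \<open>c a \<noteq> 0\<close> by (auto simp: B_def)
  then obtain b where b: "b \<in> B" "\<And>b'. b' \<in> B \<Longrightarrow> degree (p b') \<le> degree (p b)"
    using Max_in[of "(\<lambda>b. degree (p b)) ` B"] Max_ge[of "(\<lambda>b. degree (p b)) ` B"] by fastforce
  have "0 = coeff (\<Sum>a\<in>A. smult (c a) (p a)) (degree (p b))" by (simp add: sum0)
  also have "\<dots> = (\<Sum>a\<in>A. c a * coeff (p a) (degree (p b)))" by (simp add: coeff_sum)
  also have "\<dots> = (\<Sum>a\<in>A. if a = b then c b * lead_coeff (p b) else 0)"
  proof (rule sum.cong)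
    fix a assume a: "a \<in> A"
    show "c a * coeff (p a) (degree (p b)) = (if a = b then c b * lead_coeff (p b) else 0)"
    proof (cases "a = b \<or> c a = 0")
      case False
      then have "degree (p a) \<noteq> degree (p b)" using inj a b(1) by (auto simp: B_def dest: inj_onD)
      then have "degree (p a) < degree (p b)" using False a b(2)[of a] by (auto simp: B_def)
      then show ?thesis using False by (simp add: coeff_eq_0)
    qed auto
  qed simp
  also have "\<dots> = c b * lead_coeff (p b)" using b(1) fin by (simp add: B_def)
  finally show False using b(1) nz by (auto simp: B_def)
qed

section \<open>Complex powers and sums of quasi-exponentials\<close>

lemma cpow_add: "cpow L w (x + y) = cpow L w x * cpow L w y"
  by (simp add: cpow_def exp_add distrib_right)

lemma cpow_of_nat:
  assumes "is_ln_branch L" "w \<noteq> 0"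
  shows "cpow L w (of_nat m) = w ^ m"
  using assms by (simp add: cpow_def exp_of_nat_mult is_ln_branch_def)

lemma cpow_nonzero: "cpow L w x \<noteq> 0"
  by (simp add: cpow_def)

lemma shift_pow_apply: "(shift ^^ j) f x = f (x + of_nat j)"
  by (induction j arbitrary: x) (simp_all add: shift_def algebra_simps)

locale exponentials =
  fixes L :: "complex \<Rightarrow> complex" and n :: nat and alpha :: "nat \<Rightarrow> complex"
  assumes branch: "is_ln_branch L" and inj: "inj_on alpha {..<n}"
    and nz: "\<And>i. i < n \<Longrightarrow> alpha i \<noteq> 0"
begin

definition qe :: "(nat \<Rightarrow> complex poly) \<Rightarrow> complex \<Rightarrow> complex" where
  "qe p x = (\<Sum>i<n. cpow L (alpha i) x * poly (p i) x)"

lemma qe_translate: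
  "qe p (y + x) = qe (\<lambda>i. smult (cpow L (alpha i) x) (p i \<circ>\<^sub>p [:x, 1:])) y"
  by (simp add: qe_def poly_pcompose cpow_add algebra_simps)

text \<open>Translation by \<open>x\<close> moves the zeros to \<open>0, 1, ...\<close>, where the
  powers become \<open>alpha i ^ m\<close> and \<open>quasi_exponential_eq_0\<close> applies. It
  changes each polynomial only by an invertible substitution and a nonzero factor.\<close>

lemma qe_vanishing:
  assumes "\<And>i. i < n \<Longrightarrow> deg_below (d i) (p i)"
    and "\<And>m. m < (\<Sum>i<n. d i) \<Longrightarrow> qe p (x + of_nat m) = 0" and i: "i < n"
  shows "p i = 0"
proof -
  have "smult (cpow L (alpha i) x) (p i \<circ>\<^sub>p [:x, 1:]) = 0"
  proof (rule quasi_exponential_eq_0[OF inj nz, where d = d])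
    fix m assume "m < (\<Sum>i<n. d i)"
    then have "qe (\<lambda>i. smult (cpow L (alpha i) x) (p i \<circ>\<^sub>p [:x, 1:])) (of_nat m) = 0"
      using assms(2)[of m] qe_translate[of p "of_nat m" x] by (simp add: add.commute)
    moreover have "qe (\<lambda>i. smult (cpow L (alpha i) x) (p i \<circ>\<^sub>p [:x, 1:])) (of_nat m) =
        (\<Sum>i<n. alpha i ^ m * poly (smult (cpow L (alpha i) x) (p i \<circ>\<^sub>p [:x, 1:])) (of_nat m))"
      unfolding qe_def by (rule sum.cong) (simp_all add: cpow_of_nat branch nz)
    ultimately show "(\<Sum>i<n. alpha i ^ m *
        poly (smult (cpow L (alpha i) x) (p i \<circ>\<^sub>p [:x, 1:])) (of_nat m)) = 0" by simp
  qed (use assms i in \<open>auto intro: deg_below_smult deg_below_translate\<close>)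
  then have "p i \<circ>\<^sub>p [:x, 1:] = 0" by (simp add: cpow_nonzero)
  then have "lead_coeff (p i) = 0" using lead_coeff_translate[of "p i" x] by simp
  then show ?thesis by simp
qed

text \<open>The bounds \<open>Suc (degree (p i))\<close> always hold, and a function that is zero
  everywhere has all the zeros they require. Hence a quasi-exponential determines its
  polynomials.\<close>

lemma qe_eq_0:
  assumes "\<And>x. qe p x = 0" "i < n"
  shows "p i = 0"
  using assms by (intro qe_vanishing[where d = "\<lambda>i. Suc (degree (p i))"]) (auto simp: deg_below_Suc_degree)

lemma lincomb_qe:
  assumes "\<And>i. i < n \<Longrightarrow> finite (A i)"
  shows "lincomb c (\<lambda>(i, a) x. cpow L (alpha i) x * poly (p i a) x) (SIGMA i:{..<n}. A i) =
    qe (\<lambda>i. \<Sum>a\<in>A i. smult (c (i, a)) (p i a))"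
proof
  fix x
  have "lincomb c (\<lambda>(i, a) x. cpow L (alpha i) x * poly (p i a) x) (SIGMA i:{..<n}. A i) x =
      (\<Sum>i<n. \<Sum>a\<in>A i. c (i, a) * (cpow L (alpha i) x * poly (p i a) x))"
    using assms by (subst sum.Sigma) (auto simp: lincomb_def case_prod_unfold)
  also have "\<dots> = qe (\<lambda>i. \<Sum>a\<in>A i. smult (c (i, a)) (p i a)) x"
    by (simp add: qe_def poly_sum sum_distrib_left algebra_simps)
  finally show "lincomb c (\<lambda>(i, a) x. cpow L (alpha i) x * poly (p i a) x) (SIGMA i:{..<n}. A i) x =
      qe (\<lambda>i. \<Sum>a\<in>A i. smult (c (i, a)) (p i a)) x" .
qed

text \<open>A linear relation splits into one relation for each exponential by
  \<open>qe_eq_0\<close>; there the distinct degrees force the coefficients to vanish.\<close>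

lemma indep_fam_qe:
  assumes "\<And>i. i < n \<Longrightarrow> finite (A i)" "\<And>i. i < n \<Longrightarrow> inj_on (\<lambda>a. degree (p i a)) (A i)"
    and "\<And>i a. i < n \<Longrightarrow> a \<in> A i \<Longrightarrow> p i a \<noteq> 0"
  shows "indep_fam (\<lambda>(i, a) x. cpow L (alpha i) x * poly (p i a) x) (SIGMA i:{..<n}. A i)"
  unfolding indep_fam_def
proof (intro allI impI ballI)
  fix c ia
  assume c: "lincomb c (\<lambda>(i, a) x. cpow L (alpha i) x * poly (p i a) x) (SIGMA i:{..<n}. A i) = (\<lambda>_. 0)"
    and ia: "ia \<in> (SIGMA i:{..<n}. A i)"
  obtain i a where [simp]: "ia = (i, a)" by (cases ia)
  have i: "i < n" "a \<in> A i" using ia by auto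
  have "(\<Sum>a\<in>A i. smult (c (i, a)) (p i a)) = 0"
    by (rule qe_eq_0[OF _ i(1), where p = "\<lambda>i. \<Sum>a\<in>A i. smult (c (i, a)) (p i a)"])
      (use c lincomb_qe[of A c p] assms(1) in \<open>simp add: fun_eq_iff\<close>)
  then show "c ia = 0"
    using poly_lin_indep_degree[of "A i" "p i" "\<lambda>a. c (i, a)" a] assms i by simp
qed

end

section \<open>The kernel and the annihilator\<close>

text \<open>This discards the signs of Cramer's rule.\<close>

lemma span_fscale_family:
  assumes "\<And>a. a \<in> I \<Longrightarrow> s a \<noteq> 0"
  shows "cfun.span ((\<lambda>a. fscale (s a) (u a)) ` I) = cfun.span (u ` I)"
proof
  show "cfun.span ((\<lambda>a. fscale (s a) (u a)) ` I) \<subseteq> cfun.span (u ` I)"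
    by (intro cfun.span_minimal image_subsetI cfun.span_scale cfun.span_base) auto
  have "u a \<in> cfun.span ((\<lambda>a. fscale (s a) (u a)) ` I)" if "a \<in> I" for a
  proof -
    have "fscale (1 / s a) (fscale (s a) (u a)) \<in> cfun.span ((\<lambda>a. fscale (s a) (u a)) ` I)"
      using that by (intro cfun.span_scale cfun.span_base) auto
    moreover have "fscale (1 / s a) (fscale (s a) (u a)) = u a"
      using assms[OF that] by (simp add: fscale_def)
    ultimately show ?thesis by simp
  qed
  then show "cfun.span (u ` I) \<subseteq> cfun.span ((\<lambda>a. fscale (s a) (u a)) ` I)"
    by (intro cfun.span_minimal) auto
qed

text \<open>The degree bounds \<open>d\<close> stay arbitrary. With
  \<open>d i = mu i 0 + conj_part (mu i) 0\<close> the space \<open>H\<close> below becomes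
  \<open>W_hat\<close>.\<close>

locale quasi_exponentials = exponentials +
  fixes d :: "nat \<Rightarrow> nat"
begin

section \<open>The space of quasi-exponentials of bounded degree\<close>

definition D :: nat where
  "D = (\<Sum>i<n. d i)"

definition H :: "(complex \<Rightarrow> complex) set" where
  "H = {qe p |p. \<forall>i<n. deg_below (d i) (p i)}"

definition qe_monom :: "nat \<times> nat \<Rightarrow> complex \<Rightarrow> complex" where
  "qe_monom = (\<lambda>(i, r) x. cpow L (alpha i) x * poly (monom 1 r) x)"

lemma H_vanishing:
  assumes "f \<in> H" "\<And>m. m < D \<Longrightarrow> f (x + of_nat m) = 0"
  shows "f = (\<lambda>_. 0)"
proof -
  obtain p where p: "f = qe p" "\<And>i. i < n \<Longrightarrow> deg_below (d i) (p i)"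
    using assms(1) by (auto simp: H_def)
  have "p i = 0" if "i < n" for i
    by (rule qe_vanishing[where d = d and x = x]) (use p assms(2) that in \<open>auto simp: D_def\<close>)
  then show ?thesis by (simp add: p(1) qe_def fun_eq_iff)
qed

lemma H_translate:
  assumes "f \<in> H"
  shows "(\<lambda>y. f (y + x)) \<in> H"
proof -
  obtain p where p: "f = qe p" "\<And>i. i < n \<Longrightarrow> deg_below (d i) (p i)"
    using assms by (auto simp: H_def)
  then have "(\<lambda>y. f (y + x)) = qe (\<lambda>i. smult (cpow L (alpha i) x) (p i \<circ>\<^sub>p [:x, 1:]))"
    by (simp add: qe_translate fun_eq_iff)
  then show ?thesis unfolding H_def using p(2)
    by (blast intro: deg_below_smult deg_below_translate)
qed

lemma H_eq_span: "H = cfun.span (qe_monom ` (SIGMA i:{..<n}. {..<d i}))"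
proof -
  have "cfun.span (qe_monom ` (SIGMA i:{..<n}. {..<d i})) =
      range (\<lambda>c. qe (\<lambda>i. \<Sum>r<d i. smult (c (i, r)) (monom 1 r)))"
    by (simp add: span_family qe_monom_def lincomb_qe)
  also have "\<dots> = H"
  proof (intro equalityI subsetI)
    fix f assume "f \<in> range (\<lambda>c. qe (\<lambda>i. \<Sum>r<d i. smult (c (i, r)) (monom 1 r)))"
    then obtain c where f: "f = qe (\<lambda>i. \<Sum>r<d i. smult (c (i, r)) (monom 1 r))" by blast
    have "deg_below (d i) (\<Sum>r<d i. smult (c (i, r)) (monom 1 r))" for i
      by (auto simp: deg_below_def coeff_sum)
    then show "f \<in> H" unfolding H_def f by blast
  next
    fix f assume "f \<in> H"
    then obtain p where p: "f = qe p" "\<And>i. i < n \<Longrightarrow> deg_below (d i) (p i)"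
      by (auto simp: H_def)
    have "p i = (\<Sum>r<d i. smult (coeff (p i) r) (monom 1 r))" if "i < n" for i
      by (rule poly_eqI) (use p(2)[OF that] in
          \<open>auto simp: coeff_sum deg_below_def if_distrib[of "\<lambda>c. _ * c"] cong: if_cong\<close>)
    then have "f = qe (\<lambda>i. \<Sum>r<d i. smult (coeff (p i) r) (monom 1 r))"
      unfolding p(1) qe_def by (intro ext sum.cong refl) (metis lessThan_iff)
    then show "f \<in> range (\<lambda>c. qe (\<lambda>i. \<Sum>r<d i. smult (c (i, r)) (monom 1 r)))"
      by (intro range_eqI[where x = "\<lambda>(i, r). coeff (p i) r"]) simp
  qed
  finally show ?thesis by simp
qed

lemma subspace_H: "cfun.subspace H"
  by (simp add: H_eq_span)

lemma indep_qe_monom: "indep_fam qe_monom (SIGMA i:{..<n}. {..<d i})"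
  unfolding qe_monom_def
  by (rule indep_fam_qe) (auto simp: degree_monom_eq inj_on_def monom_eq_0_iff)

lemma card_monomials: "card (SIGMA i:{..<n}. {..<d i}) = D"
  by (simp add: D_def)

lemma span_eq_H:
  assumes "finite I" "indep_fam u I" "u ` I \<subseteq> H" "card I = D"
  shows "cfun.span (u ` I) = H"
  unfolding H_eq_span
  by (rule span_eq_of_card) (use assms in \<open>auto simp: H_eq_span card_monomials D_def\<close>)

lemma card_basis_H:
  assumes "finite I" "indep_fam u I" "cfun.span (u ` I) = H"
  shows "card I = D"
proof (rule antisym)
  have fin: "finite (SIGMA i:{..<n}. {..<d i})" by auto
  show "card I \<le> D"
    using card_le_of_indep_fam[OF assms(1) fin assms(2)] assms(3) cfun.span_superset
    unfolding card_monomials H_eq_span by metis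
  show "D \<le> card I"
    using card_le_of_indep_fam[OF fin assms(1) indep_qe_monom, of u] assms(3) cfun.span_superset
    unfolding card_monomials H_eq_span by metis
qed

lemma length_basis_H: "is_basis us H \<Longrightarrow> length us = D"
  using card_basis_H[of "{..<length us}" "(!) us"] by (simp add: is_basis_nth)

lemma ex_basis_H: "\<exists>us. is_basis us H"
proof -
  obtain xs where "set xs = (SIGMA i:{..<n}. {..<d i})" "distinct xs"
    using finite_distinct_list[of "SIGMA i:{..<n}. {..<d i}"] by auto
  then have "is_basis (map qe_monom xs) H"
    using is_basis_map indep_qe_monom H_eq_span by metis
  then show ?thesis ..
qed

text \<open>A null vector of the transposed Casorati matrix gives a combination of the basis that
  vanishes at \<open>x, x + 1, ..., x + D - 1\<close>, hence everywhere.\<close>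

lemma dwronskian_nonzero:
  assumes us: "is_basis us H"
  shows "dwronskian us x \<noteq> 0"
proof
  let ?A = "mat D D (\<lambda>(i, j). (us ! i) (x + of_nat j))"
  have len: "length us = D" by (rule length_basis_H[OF us])
  have A: "?A \<in> carrier_mat D D" by simp
  assume "dwronskian us x = 0"
  then have "det (transpose_mat ?A) = 0"
    using det_transpose[OF A] by (simp add: dwronskian_def shift_pow_apply len)
  then obtain v where v: "v \<in> carrier_vec D" "v \<noteq> 0\<^sub>v D" "transpose_mat ?A *\<^sub>v v = 0\<^sub>v D"
    using det_0_iff_vec_prod_zero[of "transpose_mat ?A" D] by auto
  have "lincomb (($) v) ((!) us) {..<D} = (\<lambda>_. 0)"
  proof (rule H_vanishing)
    show "lincomb (($) v) ((!) us) {..<D} \<in> H"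
      using us len span_family[of "{..<D}" "(!) us"] by (auto simp: is_basis_nth)
  next
    fix m assume m: "m < D"
    have "(transpose_mat ?A *\<^sub>v v) $ m = (\<Sum>a<D. (us ! a) (x + of_nat m) * v $ a)"
      using m v(1) by (simp add: scalar_prod_def atLeast0LessThan)
    then show "lincomb (($) v) ((!) us) {..<D} (x + of_nat m) = 0"
      using v(3) m by (simp add: lincomb_def mult.commute)
  qed
  then have "v $ a = 0" if "a < D" for a
    using us len that by (auto simp: is_basis_nth indep_fam_def)
  then have "v = 0\<^sub>v D" using v(1) by (intro eq_vecI) auto
  with v(2) show False ..
qed

text \<open>This is entry \<open>a\<close> of the last row of the inverse of the Casorati matrix
  with entries \<open>(us ! i) (x + j)\<close>: a cofactor for the last column divided by the
  determinant.\<close>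

definition cramer :: "(complex \<Rightarrow> complex) list \<Rightarrow> nat \<Rightarrow> complex \<Rightarrow> complex" where
  "cramer us a x =
     (- 1) ^ (a + (D - 1)) * (dwronskian (take a us @ drop (Suc a) us) x / dwronskian us x)"

lemma cramer_sum:
  assumes us: "is_basis us H" and j: "j < D"
  shows "(\<Sum>a<D. cramer us a x * (us ! a) (x + of_nat j)) = (if Suc j = D then 1 else 0)"
proof -
  let ?A = "mat D D (\<lambda>(i, j). (us ! i) (x + of_nat j))"
  have len: "length us = D" by (rule length_basis_H[OF us])
  have A: "?A \<in> carrier_mat D D" by simp
  have detA: "det ?A = dwronskian us x" by (simp add: dwronskian_def shift_pow_apply len)
  \<comment> \<open>Deleting the last column leaves the shifts \<open>0, ..., D - 2\<close>, so the
    minor is the Wronskian of the list without \<open>us ! a\<close>.\<close>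
  have cof: "cofactor ?A a (D - 1) = (- 1) ^ (a + (D - 1)) * dwronskian (take a us @ drop (Suc a) us) x"
    if a: "a < D" for a
  proof -
    have "mat_delete ?A a (D - 1) = mat (length (take a us @ drop (Suc a) us))
        (length (take a us @ drop (Suc a) us))
        (\<lambda>(i, j). (shift ^^ j) ((take a us @ drop (Suc a) us) ! i) x)"
      using a len
      by (intro eq_matI) (auto simp: mat_delete_def shift_pow_apply nth_append min_def)
    then show ?thesis by (simp add: cofactor_def dwronskian_def)
  qed
  have "(adj_mat ?A * ?A) $$ (D - 1, j) = (det ?A \<cdot>\<^sub>m 1\<^sub>m D) $$ (D - 1, j)"
    using adj_mat(3)[OF A] by simp
  moreover have "(adj_mat ?A * ?A) $$ (D - 1, j) =
      (\<Sum>a<D. cofactor ?A a (D - 1) * (us ! a) (x + of_nat j))"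
    using j by (simp add: adj_mat_def scalar_prod_def atLeast0LessThan)
  moreover have "(det ?A \<cdot>\<^sub>m 1\<^sub>m D) $$ (D - 1, j) = (if Suc j = D then det ?A else 0)"
    using j by auto
  ultimately have "(\<Sum>a<D. cofactor ?A a (D - 1) * (us ! a) (x + of_nat j)) =
      (if Suc j = D then dwronskian us x else 0)"
    by (simp add: detA)
  moreover have "(\<Sum>a<D. cramer us a x * (us ! a) (x + of_nat j)) =
      (\<Sum>a<D. cofactor ?A a (D - 1) * (us ! a) (x + of_nat j)) / dwronskian us x"
    unfolding sum_divide_distrib by (rule sum.cong) (simp_all only: lessThan_iff cof cramer_def times_divide_eq_left times_divide_eq_right)
  ultimately show ?thesis using dwronskian_nonzero[OF us] by simp
qed

text \<open>
  The translates of \<open>ker\<close> are the rows of the inverse of the Casorati matrix of any basis of \<open>H\<close>,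
  see \<open>ker_cramer\<close>; \<open>ker\<close> itself does not depend on the basis.
\<close>

definition ker :: "complex \<Rightarrow> complex" where
  "ker = (SOME k. k \<in> H \<and> (\<forall>j<D. k (of_nat j) = (if Suc j = D then 1 else 0)))"

text \<open>The combination of a basis with Cramer's coefficients at \<open>x = 0\<close> has the
  required values, so the choice in \<open>ker\<close> is justified.\<close>

lemma ker: "ker \<in> H" "j < D \<Longrightarrow> ker (of_nat j) = (if Suc j = D then 1 else 0)"
proof -
  obtain us where us: "is_basis us H" using ex_basis_H by blast
  have "lincomb (\<lambda>a. cramer us a 0) ((!) us) {..<D} \<in> H"
    using us length_basis_H[OF us] span_family[of "{..<D}" "(!) us"] by (auto simp: is_basis_nth)
  moreover have "lincomb (\<lambda>a. cramer us a 0) ((!) us) {..<D} (of_nat j) = (if Suc j = D then 1 else 0)"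
    if "j < D" for j
    using cramer_sum[OF us that, of 0] by (simp add: lincomb_def)
  ultimately have "\<exists>k. k \<in> H \<and> (\<forall>j<D. k (of_nat j) = (if Suc j = D then 1 else 0))" by blast
  from someI_ex[OF this] show "ker \<in> H" "j < D \<Longrightarrow> ker (of_nat j) = (if Suc j = D then 1 else 0)"
    unfolding ker_def by blast+
qed

lemma ker_translate: "(\<lambda>y. ker (y - x)) \<in> H"
  using H_translate[OF ker(1), of "- x"] by simp

text \<open>Both sides, as functions of \<open>y\<close>, lie in \<open>H\<close> and agree at the
  \<open>D\<close> points \<open>x, ..., x + D - 1\<close>.\<close>

lemma ker_cramer:
  assumes us: "is_basis us H"
  shows "ker (y - x) = (\<Sum>a<D. cramer us a x * (us ! a) y)"
proof -
  let ?f = "lincomb (\<lambda>a. cramer us a x) ((!) us) {..<D}"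
  have "(\<lambda>y. ker (y - x)) - ?f = (\<lambda>_. 0)"
  proof (rule H_vanishing[of _ x])
    have "?f \<in> H"
      using us length_basis_H[OF us] span_family[of "{..<D}" "(!) us"] by (auto simp: is_basis_nth)
    then show "(\<lambda>y. ker (y - x)) - ?f \<in> H"
      by (rule cfun.subspace_diff[OF subspace_H ker_translate])
  next
    fix m assume "m < D"
    then show "((\<lambda>y. ker (y - x)) - ?f) (x + of_nat m) = 0"
      using cramer_sum[OF us, of m x] ker(2)[of m] by (simp add: lincomb_def)
  qed
  then show ?thesis by (simp add: fun_eq_iff lincomb_def)
qed

text \<open>Functionals vanishing on \<open>W\<close> are represented by functions, through their
  action on translates of \<open>ker\<close>. The argument \<open>x + 1\<close> accounts for the
  operator \<open>T\<close> in \<open>phi_fun\<close>.\<close>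

definition annihilator :: "(complex \<Rightarrow> complex) set \<Rightarrow> (complex \<Rightarrow> complex) set" where
  "annihilator W = {g. \<exists>\<phi>. Vector_Spaces.linear fscale (*) \<phi> \<and> (\<forall>f\<in>W. \<phi> f = 0) \<and>
     g = (\<lambda>x. \<phi> (\<lambda>y. ker (y - (x + 1))))}"

text \<open>A functional vanishing on the \<open>I1\<close> part sees only the \<open>I2\<close>
  terms of the expansion of \<open>ker\<close>, with coefficients \<open>\<phi> (u a)\<close>; by
  independence these coefficients are arbitrary.\<close>

lemma annihilator_eq_span:
  assumes fin: "finite I1" "finite I2" and disj: "I1 \<inter> I2 = {}"
    and ind: "indep_fam u (I1 \<union> I2)" and W: "cfun.span (u ` I1) = W"
    and v: "\<And>x y. ker (y - x) = (\<Sum>a\<in>I1 \<union> I2. v a x * u a y)"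
  shows "annihilator W = cfun.span ((\<lambda>a x. v a (x + 1)) ` I2)"
proof -
  have apply_functional: "\<phi> (\<lambda>y. ker (y - (x + 1))) = (\<Sum>a\<in>I2. \<phi> (u a) * v a (x + 1))"
    if "Vector_Spaces.linear fscale (*) \<phi>" "\<forall>a\<in>I1. \<phi> (u a) = 0" for \<phi> x
  proof -
    have "\<phi> (\<lambda>y. ker (y - (x + 1))) = \<phi> (lincomb (\<lambda>a. v a (x + 1)) u (I1 \<union> I2))"
      by (simp add: lincomb_def v)
    also have "\<dots> = (\<Sum>a\<in>I1 \<union> I2. v a (x + 1) * \<phi> (u a))" by (rule linear_lincomb[OF that(1)])
    also have "\<dots> = (\<Sum>a\<in>I2. \<phi> (u a) * v a (x + 1))"
      using that(2) fin disj by (simp add: sum.union_disjoint mult.commute)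
    finally show ?thesis .
  qed
  have zero_iff: "(\<forall>f\<in>W. \<phi> f = 0) \<longleftrightarrow> (\<forall>a\<in>I1. \<phi> (u a) = 0)"
    if "Vector_Spaces.linear fscale (*) \<phi>" for \<phi>
  proof
    assume "\<forall>f\<in>W. \<phi> f = 0"
    moreover have "u a \<in> W" if "a \<in> I1" for a unfolding W[symmetric] by (rule cfun.span_base) (use that in blast)
    ultimately show "\<forall>a\<in>I1. \<phi> (u a) = 0" by blast
  next
    assume z: "\<forall>a\<in>I1. \<phi> (u a) = 0"
    show "\<forall>f\<in>W. \<phi> f = 0"
    proof
      fix f assume "f \<in> W"
      then obtain c where "f = lincomb c u I1" using span_family[OF fin(1), of u] W by blast
      then show "\<phi> f = 0" using linear_lincomb[OF that, of c u I1] z by simp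
    qed
  qed
  show ?thesis
  proof (intro equalityI subsetI)
    fix g assume "g \<in> annihilator W"
    then obtain \<phi> where \<phi>: "Vector_Spaces.linear fscale (*) \<phi>" "\<forall>f\<in>W. \<phi> f = 0"
      "g = (\<lambda>x. \<phi> (\<lambda>y. ker (y - (x + 1))))" unfolding annihilator_def by blast
    have "g = lincomb (\<lambda>a. \<phi> (u a)) (\<lambda>a x. v a (x + 1)) I2"
      unfolding \<phi>(3) lincomb_def using apply_functional[OF \<phi>(1)] zero_iff[OF \<phi>(1)] \<phi>(2) by blast
    then show "g \<in> cfun.span ((\<lambda>a x. v a (x + 1)) ` I2)" unfolding span_family[OF fin(2)] by blast
  next
    fix g assume "g \<in> cfun.span ((\<lambda>a x. v a (x + 1)) ` I2)"
    then obtain c where g: "g = lincomb c (\<lambda>a x. v a (x + 1)) I2" unfolding span_family[OF fin(2)] by blast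
    obtain \<phi> where \<phi>: "Vector_Spaces.linear fscale (*) \<phi>"
      "\<forall>a\<in>I1 \<union> I2. \<phi> (u a) = (if a \<in> I1 then 0 else c a)"
      using linear_functional_exists[OF _ ind, of "\<lambda>a. if a \<in> I1 then 0 else c a"] fin by blast
    have z: "\<forall>a\<in>I1. \<phi> (u a) = 0" using \<phi>(2) by simp
    have "\<phi> (u a) = c a" if "a \<in> I2" for a using \<phi>(2) disj that by auto
    then have "g = (\<lambda>x. \<phi> (\<lambda>y. ker (y - (x + 1))))"
      unfolding g lincomb_def apply_functional[OF \<phi>(1) z] by (intro ext sum.cong) auto
    then show "g \<in> annihilator W"
      unfolding annihilator_def using \<phi>(1) zero_iff[OF \<phi>(1)] z by blast
  qed
qed

text \<open>The functions dual to \<open>hs\<close> are the Wronskian quotients up to sign, so every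
  completion \<open>hs\<close> yields the same space.\<close>

lemma span_phi_fun:
  assumes fs: "is_basis fs W" and us: "is_basis (fs @ hs) H"
  shows "cfun.span (phi_fun fs hs ` {..<length hs}) = annihilator W"
proof -
  define I2 where "I2 = (\<lambda>b. length fs + b) ` {..<length hs}"
  have len: "length fs + length hs = D" using length_basis_H[OF us] by simp
  have un: "{..<length fs} \<union> I2 = {..<D}"
  proof (intro equalityI subsetI)
    fix a assume "a \<in> {..<D}"
    then have "a < length fs \<or> a = length fs + (a - length fs) \<and> a - length fs < length hs" using len by auto
    then show "a \<in> {..<length fs} \<union> I2" unfolding I2_def by blast
  qed (use len in \<open>auto simp: I2_def\<close>)
  have "annihilator W = cfun.span ((\<lambda>a x. cramer (fs @ hs) a (x + 1)) ` I2)"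
  proof (rule annihilator_eq_span)
    show "indep_fam ((!) (fs @ hs)) ({..<length fs} \<union> I2)"
      using us len un by (simp add: is_basis_nth)
    have "(!) (fs @ hs) ` {..<length fs} = (!) fs ` {..<length fs}"
      by (rule image_cong) (auto simp: nth_append)
    then show "cfun.span ((!) (fs @ hs) ` {..<length fs}) = W"
      using fs by (simp add: is_basis_nth)
    show "ker (y - x) = (\<Sum>a\<in>{..<length fs} \<union> I2. cramer (fs @ hs) a x * ((fs @ hs) ! a) y)" for x y
      unfolding un by (rule ker_cramer[OF us])
  qed (auto simp: I2_def)
  \<comment> \<open>Removing entry \<open>length fs + b\<close> from \<open>fs @ hs\<close> removes
    \<open>hs ! b\<close> and keeps \<open>fs\<close>.\<close>
  also have "(\<lambda>a x. cramer (fs @ hs) a (x + 1)) ` I2 =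
      (\<lambda>b. fscale ((- 1) ^ (length fs + b + (D - 1))) (phi_fun fs hs b)) ` {..<length hs}"
    by (simp add: I2_def image_image cramer_def phi_fun_def fscale_def shift_def)
  also have "cfun.span \<dots> = cfun.span (phi_fun fs hs ` {..<length hs})"
    by (rule span_fscale_family) simp
  finally show ?thesis ..
qed

end

section \<open>Coefficients of translated polynomials\<close>

lemma pcompose_eq_sum:
  fixes p q :: "complex poly"
  shows "p \<circ>\<^sub>p q = (\<Sum>m\<le>degree p. smult (coeff p m) (q ^ m))"
proof (rule poly_eq_poly_eq_iff[THEN iffD1], rule ext)
  fix x
  show "poly (p \<circ>\<^sub>p q) x = poly (\<Sum>m\<le>degree p. smult (coeff p m) (q ^ m)) x"
    by (simp add: poly_pcompose poly_altdef[of p] poly_sum)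
qed

text \<open>Expanding each \<open>(y - x) ^ m\<close> by the binomial theorem gives a polynomial in
  \<open>x\<close> as the coefficient of \<open>y ^ r\<close>; its top term comes from
  \<open>m = degree p\<close> alone.\<close>

lemma ex_coeff_translate:
  fixes p :: "complex poly"
  shows "\<exists>c. (\<forall>x. coeff (p \<circ>\<^sub>p [:- x, 1:]) r = poly c x) \<and> deg_below (Suc (degree p - r)) c \<and>
    (r \<le> degree p \<longrightarrow>
      coeff c (degree p - r) = lead_coeff p * of_nat (degree p choose r) * (- 1) ^ (degree p - r))"
proof -
  define c where
    "c = (\<Sum>m\<in>{r..degree p}. monom (coeff p m * of_nat (m choose r) * (- 1) ^ (m - r)) (m - r))"
  have "coeff (p \<circ>\<^sub>p [:- x, 1:]) r = poly c x" for x
  proof -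
    have "coeff (p \<circ>\<^sub>p [:- x, 1:]) r = (\<Sum>m\<le>degree p. coeff p m * coeff ([:- x, 1:] ^ m) r)"
      by (simp add: pcompose_eq_sum coeff_sum)
    also have "\<dots> = (\<Sum>m\<in>{r..degree p}. coeff p m * coeff ([:- x, 1:] ^ m) r)"
    proof (rule sum.mono_neutral_right)
      show "\<forall>m\<in>{..degree p} - {r..degree p}. coeff p m * coeff ([:- x, 1:] ^ m) r = 0"
        by (auto simp: coeff_eq_0 degree_linear_power)
    qed auto
    also have "\<dots> = poly c x"
      unfolding c_def poly_sum
      by (rule sum.cong)
        (simp_all add: coeff_linear_poly_power poly_monom power_minus[of x] algebra_simps)
    finally show ?thesis .
  qed
  moreover have "deg_below (Suc (degree p - r)) c"
    by (auto simp: deg_below_def c_def coeff_sum intro!: sum.neutral)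
  moreover have "coeff c (degree p - r) = lead_coeff p * of_nat (degree p choose r) * (- 1) ^ (degree p - r)"
    if "r \<le> degree p"
  proof -
    have "coeff c (degree p - r) = (\<Sum>m\<in>{r..degree p}. if m = degree p then
        coeff p m * of_nat (m choose r) * (- 1) ^ (m - r) else 0)"
      unfolding c_def coeff_sum by (rule sum.cong) auto
    then show ?thesis using that by simp
  qed
  ultimately show ?thesis by blast
qed

lemma indep_fam_nonzero:
  assumes "finite I" "indep_fam u I" "a \<in> I"
  shows "u a \<noteq> (\<lambda>_. 0)"
proof
  assume "u a = (\<lambda>_. 0)"
  then have "lincomb (\<lambda>b. if b = a then 1 else 0) u I = (\<lambda>_. 0)"
    by (auto simp: lincomb_def fun_eq_iff intro!: sum.neutral)
  from indep_famD[OF assms(2) this assms(3)] show False by simp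
qed

section \<open>Vanishing orders\<close>

definition vanishing_order :: "(complex \<Rightarrow> complex) \<Rightarrow> complex \<Rightarrow> nat \<Rightarrow> bool" where
  "vanishing_order f z e \<longleftrightarrow> (\<forall>j<e. f (z + of_nat j) = 0) \<and> f (z + of_nat e) \<noteq> 0"

lemma vanishing_order_unique: "vanishing_order f z e \<Longrightarrow> vanishing_order f z e' \<Longrightarrow> e = e'"
  unfolding vanishing_order_def by (metis nat_neq_iff)

text \<open>Among the terms with nonzero coefficient, the one of smallest order decides: the others
  still vanish at the point where it does not.\<close>

lemma vanishing_order_lincomb:
  assumes fin: "finite I" and inj: "inj_on ord I"
    and ord: "\<And>a. a \<in> I \<Longrightarrow> vanishing_order (u a) z (ord a)"
    and c: "a \<in> I" "c a \<noteq> 0"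
  shows "\<exists>b\<in>I. vanishing_order (lincomb c u I) z (ord b)"
proof -
  define B where "B = {a \<in> I. c a \<noteq> 0}"
  have B: "finite B" "B \<noteq> {}" using fin c by (auto simp: B_def)
  then obtain b where b: "b \<in> B" "\<And>b'. b' \<in> B \<Longrightarrow> ord b \<le> ord b'"
    using Min_in[of "ord ` B"] Min_le[of "ord ` B"] by fastforce
  have zero: "c a * u a (z + of_nat j) = 0" if "a \<in> I" "j < ord b \<or> j = ord b \<and> a \<noteq> b" for a j
  proof (cases "c a = 0")
    case False
    then have "ord b \<le> ord a" using that(1) b(2) by (simp add: B_def)
    moreover have "ord a \<noteq> ord b" if "a \<noteq> b" using inj \<open>a \<in> I\<close> b(1) that by (auto simp: B_def dest: inj_onD)
    ultimately have "j < ord a" using that(2) by fastforce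
    then show ?thesis using ord[OF that(1)] by (simp add: vanishing_order_def)
  qed simp
  have "lincomb c u I (z + of_nat (ord b)) = c b * u b (z + of_nat (ord b))"
  proof -
    have "(\<Sum>a\<in>I - {b}. c a * u a (z + of_nat (ord b))) = 0"
      by (rule sum.neutral) (use zero in blast)
    then show ?thesis using b(1) fin by (simp add: lincomb_def B_def sum.remove[of I b])
  qed
  then have "vanishing_order (lincomb c u I) z (ord b)"
    using b(1) ord[of b] zero by (auto simp: vanishing_order_def lincomb_def B_def intro!: sum.neutral)
  then show ?thesis using b(1) by (auto simp: B_def)
qed

lemma indep_fam_vanishing_order:
  assumes "finite I" "inj_on ord I" "\<And>a. a \<in> I \<Longrightarrow> vanishing_order (u a) z (ord a)"
  shows "indep_fam u I"
  unfolding indep_fam_def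
proof (intro allI impI ballI, rule ccontr)
  fix c a assume "lincomb c u I = (\<lambda>_. 0)" "a \<in> I" "c a \<noteq> 0"
  then show False
    using vanishing_order_lincomb[OF assms, of a c] by (auto simp: vanishing_order_def)
qed

section \<open>Discrete exponents as vanishing orders\<close>

lemma has_discrete_exponents_iff:
  "has_discrete_exponents W z es \<longleftrightarrow> sorted_wrt (>) es \<and>
     (\<exists>psi. is_basis psi W \<and> length psi = length es \<and>
        (\<forall>i < length es. vanishing_order (psi ! i) z (es ! i)))"
  by (simp add: has_discrete_exponents_def vanishing_order_def shift_pow_apply)

text \<open>This describes the exponents without reference to a basis, which yields their
  uniqueness.\<close>

lemma set_discrete_exponents:
  assumes "has_discrete_exponents W z es"
  shows "set es = {e. \<exists>f\<in>W. vanishing_order f z e}"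
proof -
  obtain psi where sorted: "sorted_wrt (>) es" and psi: "is_basis psi W" "length psi = length es"
    "\<And>i. i < length es \<Longrightarrow> vanishing_order (psi ! i) z (es ! i)"
    using assms by (auto simp: has_discrete_exponents_iff)
  have inj: "inj_on ((!) es) {..<length es}"
    using sorted_wrt_nth_less[OF sorted] by (intro linorder_inj_onI) fastforce+
  have W: "W = range (\<lambda>c. lincomb c ((!) psi) {..<length es})"
    using psi span_family[of "{..<length es}" "(!) psi"] by (simp add: is_basis_nth)
  have mem: "psi ! i \<in> W" if "i < length es" for i
    using psi(1,2) that cfun.span_base[of "psi ! i" "(!) psi ` {..<length psi}"] by (auto simp: is_basis_nth)
  show ?thesis
  proof (intro equalityI subsetI)
    fix e assume "e \<in> set es"
    then show "e \<in> {e. \<exists>f\<in>W. vanishing_order f z e}"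
      using psi(3) mem by (auto simp: in_set_conv_nth)
  next
    fix e assume "e \<in> {e. \<exists>f\<in>W. vanishing_order f z e}"
    then obtain c where c: "vanishing_order (lincomb c ((!) psi) {..<length es}) z e" using W by auto
    then have "lincomb c ((!) psi) {..<length es} (z + of_nat e) \<noteq> 0" by (simp add: vanishing_order_def)
    then obtain a where "a < length es" "c a \<noteq> 0"
      unfolding lincomb_def by (metis (no_types, lifting) lessThan_iff mult_zero_left sum.neutral)
    then obtain b where "b < length es" "vanishing_order (lincomb c ((!) psi) {..<length es}) z (es ! b)"
      using vanishing_order_lincomb[OF _ inj, of "(!) psi" z a c] psi(3) by auto
    then show "e \<in> set es" using vanishing_order_unique[OF c] by auto
  qed
qed

lemma discrete_exponents_unique:
  assumes "has_discrete_exponents W z es" "has_discrete_exponents W z es'"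
  shows "es = es'"
proof -
  have "sorted_wrt (<) (rev es)" "sorted_wrt (<) (rev es')"
    using assms by (simp_all add: has_discrete_exponents_iff sorted_wrt_rev)
  moreover have "set (rev es) = set (rev es')"
    using set_discrete_exponents[OF assms(1)] set_discrete_exponents[OF assms(2)] by simp
  ultimately have "rev es = rev es'" by (intro strict_sorted_equal) simp_all
  then show ?thesis by simp
qed

lemma dim_of_basis:
  assumes "is_basis us W"
  shows "cfun.dim W = length us"
proof -
  have "cfun.dim W = card (set us)"
    using assms by (intro cfun.dim_eq_card) (auto simp: is_basis_def cfun.span_span)
  then show ?thesis using assms by (simp add: is_basis_def distinct_card)
qed

lemma partition_exponents_less:
  assumes "is_partition mu" "a < b" "b < N"
  shows "N + mu b - Suc b < N + mu a - Suc a"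
proof -
  have "mu b \<le> mu a" using assms by (auto simp: is_partition_def antimono_def)
  then show ?thesis using assms by linarith
qed

lemma partition_exponents_zero:
  assumes "is_partition mu" "mu 0 = 0"
  shows "map (\<lambda>i. N + mu i - Suc i) [0..<N] = rev [0..<N]"
proof -
  have "mu i = 0" for i
  proof -
    have "mu i \<le> mu 0" using assms(1) by (auto simp: is_partition_def antimono_def)
    then show ?thesis using assms(2) by simp
  qed
  then show ?thesis by (intro nth_equalityI) (auto simp: rev_nth)
qed

text \<open>By uniqueness of the exponents only the given list has to be compared with
  \<open>N - 1, ..., 0\<close>; for nonzero \<open>mu 0\<close> the two differ in their first
  entry.\<close>

lemma discrete_singular_point_iff:
  assumes "is_partition mu" "has_discrete_exponents W z (map (\<lambda>i. N + mu i - Suc i) [0..<N])" "mu N = 0"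
  shows "discrete_singular_point W z \<longleftrightarrow> mu 0 \<noteq> 0"
proof -
  obtain psi where "is_basis psi W" "length psi = N"
    using assms(2) by (auto simp: has_discrete_exponents_iff)
  then have dim: "cfun.dim W = N" using dim_of_basis by metis
  then have "discrete_singular_point W z \<longleftrightarrow>
      map (\<lambda>i. N + mu i - Suc i) [0..<N] \<noteq> rev [0..<N]"
    unfolding discrete_singular_point_def dim by (metis assms(2) discrete_exponents_unique)
  also have "\<dots> \<longleftrightarrow> mu 0 \<noteq> 0"
  proof
    assume mu0: "mu 0 \<noteq> 0"
    \<comment> \<open>If \<open>N\<close> were 0, then \<open>mu N = 0\<close> would contradict
      \<open>mu 0 \<noteq> 0\<close>; so a first entry exists.\<close>
    then have N: "0 < N" using assms(3) by (cases N) auto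
    then have "map (\<lambda>i. N + mu i - Suc i) [0..<N] ! 0 \<noteq> rev [0..<N] ! 0"
      using mu0 by (simp add: rev_nth)
    then show "map (\<lambda>i. N + mu i - Suc i) [0..<N] \<noteq> rev [0..<N]" by metis
  qed (use partition_exponents_zero[OF assms(1), of N] in blast)
  finally show ?thesis .
qed

text \<open>Reflection turns the shifted argument \<open>x + 1\<close> into \<open>1 - x\<close>;
  hence the dual singular points are \<open>1 - z\<close>.\<close>

lemma reflect_span:
  assumes "finite I"
  shows "(\<lambda>f x. f (- x)) ` cfun.span ((\<lambda>a x. v a (x + 1)) ` I) = cfun.span ((\<lambda>a x. v a (1 - x)) ` I)"
proof -
  have "(\<lambda>f x. f (- x)) (lincomb c (\<lambda>a x. v a (x + 1)) I) = lincomb c (\<lambda>a x. v a (1 - x)) I" for c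
    by (simp add: lincomb_def)
  then show ?thesis by (simp add: span_family[OF assms] image_image)
qed

section \<open>Dual families\<close>

context quasi_exponentials
begin

text \<open>If some polynomial of \<open>ker\<close> had less than maximal degree, the
  \<open>D - 1\<close> zeros \<open>0, ..., D - 2\<close> would already force
  \<open>ker = 0\<close>, against its value 1 at \<open>D - 1\<close>.\<close>

lemma ker_qe:
  obtains p where "ker = qe p" "\<And>i. i < n \<Longrightarrow> deg_below (d i) (p i)"
    "\<And>i. i < n \<Longrightarrow> 0 < d i \<Longrightarrow> p i \<noteq> 0 \<and> degree (p i) = d i - 1"
proof -
  obtain p where p: "ker = qe p" "\<And>i. i < n \<Longrightarrow> deg_below (d i) (p i)"
    using ker(1) by (auto simp: H_def)
  have "coeff (p i) (d i - 1) \<noteq> 0" if i: "i < n" "0 < d i" for i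
  proof
    assume top: "coeff (p i) (d i - 1) = 0"
    define d' where "d' = d(i := d i - 1)"
    have "(\<Sum>j<n. d j) = d i + (\<Sum>j\<in>{..<n} - {i}. d j)"
      using i by (intro sum.remove) auto
    moreover have "(\<Sum>j<n. d' j) = d' i + (\<Sum>j\<in>{..<n} - {i}. d' j)"
      using i by (intro sum.remove) auto
    moreover have "(\<Sum>j\<in>{..<n} - {i}. d' j) = (\<Sum>j\<in>{..<n} - {i}. d j)"
      by (rule sum.cong) (auto simp: d'_def)
    ultimately have D: "D = Suc (\<Sum>j<n. d' j)" using i by (simp add: d'_def D_def)
    have "deg_below (d i - 1) (p i)"
      unfolding deg_below_def
    proof (intro allI impI)
      fix m assume "d i - 1 \<le> m"
      then have "m = d i - 1 \<or> d i \<le> m" using i by linarith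
      then show "coeff (p i) m = 0" using top p(2)[OF i(1)] by (auto simp: deg_below_def)
    qed
    then have "deg_below (d' j) (p j)" if "j < n" for j using p(2)[OF that] by (simp add: d'_def)
    moreover have "qe p (0 + of_nat m) = 0" if "m < (\<Sum>j<n. d' j)" for m
      using ker(2)[of m] that D by (simp add: p(1))
    ultimately have "p j = 0" if "j < n" for j
      by (rule qe_vanishing[where d = d' and x = 0]) (use that in auto)
    then have "ker x = 0" for x by (simp add: p(1) qe_def)
    then show False using ker(2)[of "D - 1"] D by simp
  qed
  then have "p i \<noteq> 0 \<and> degree (p i) = d i - 1" if "i < n" "0 < d i" for i
    using that p(2)[OF that(1)] by (metis One_nat_def Suc_pred coeff_0 deg_below_imp_degree_less le_antisym le_degree less_Suc_eq_le)
  with p show ?thesis by (intro that) auto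
qed

text \<open>The coefficients are chosen separately for each \<open>x\<close>; how they depend on
  \<open>x\<close> is determined afterwards.\<close>

lemma ex_dual_family:
  assumes "finite I" "cfun.span (u ` I) = H"
  shows "\<exists>v. \<forall>x y. ker (y - x) = (\<Sum>a\<in>I. v a x * u a y)"
proof -
  have "\<exists>c. (\<lambda>y. ker (y - x)) = lincomb c u I" for x
    using ker_translate[of x] assms span_family[OF assms(1), of u] by auto
  then obtain c where "\<And>x. (\<lambda>y. ker (y - x)) = lincomb (c x) u I" by metis
  then have "ker (y - x) = (\<Sum>a\<in>I. c x a * u a y)" for x y
    by (metis lincomb_def)
  then show ?thesis by - (rule exI[of _ "\<lambda>a x. c x a"], blast)
qed

text \<open>
  Comparing coefficients of \<open>y\<^sup>r\<close> in \<open>\<kappa>\<^sub>i(y - x) = \<Sum>\<^sub>a w\<^sub>a(x) p\<^sub>a(y)\<close>, where \<open>\<kappa>\<^sub>i\<close> has degree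
  \<open>d\<^sub>i - 1\<close>, gives a triangular system for the \<open>w\<^sub>a\<close>.
\<close>

lemma dual_family_qe:
  assumes bij: "\<And>i. i < n \<Longrightarrow> bij_betw (\<lambda>a. degree (p i a)) {..<d i} {..<d i}"
    and nz: "\<And>i a. i < n \<Longrightarrow> a < d i \<Longrightarrow> p i a \<noteq> 0"
    and v: "\<And>x y. ker (y - x) = (\<Sum>ia\<in>(SIGMA i:{..<n}. {..<d i}).
      v ia x * (\<lambda>(i, a) x. cpow L (alpha i) x * poly (p i a) x) ia y)"
    and i: "i < n" and a: "a < d i"
  shows "\<exists>w. w \<noteq> 0 \<and> degree w = d i - Suc (degree (p i a)) \<and>
    (\<forall>x. v (i, a) x = cpow L (alpha i) (- x) * poly w x)"
proof -
  obtain k where k: "ker = qe k" "\<And>i. i < n \<Longrightarrow> 0 < d i \<Longrightarrow> k i \<noteq> 0 \<and> degree (k i) = d i - 1"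
    using ker_qe by metis
  \<comment> \<open>For fixed \<open>x\<close>, both expansions of \<open>ker (y - x)\<close> are
    quasi-exponentials in \<open>y\<close>, so their polynomials at \<open>alpha i\<close>
    agree.\<close>
  have eq: "smult (cpow L (alpha i) (- x)) (k i \<circ>\<^sub>p [:- x, 1:]) = (\<Sum>a<d i. smult (v (i, a) x) (p i a))" for x
  proof -
    have "qe (\<lambda>i. smult (cpow L (alpha i) (- x)) (k i \<circ>\<^sub>p [:- x, 1:]) -
        (\<Sum>a<d i. smult (v (i, a) x) (p i a))) y = 0" for y
    proof -
      have "qe (\<lambda>i. smult (cpow L (alpha i) (- x)) (k i \<circ>\<^sub>p [:- x, 1:]) -
          (\<Sum>a<d i. smult (v (i, a) x) (p i a))) y =
        qe (\<lambda>i. smult (cpow L (alpha i) (- x)) (k i \<circ>\<^sub>p [:- x, 1:])) y -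
        qe (\<lambda>i. \<Sum>a<d i. smult (v (i, a) x) (p i a)) y"
        by (simp add: qe_def sum_subtractf right_diff_distrib)
      also have "\<dots> = ker (y - x) - lincomb (\<lambda>ia. v ia x)
          (\<lambda>(i, a) x. cpow L (alpha i) x * poly (p i a) x) (SIGMA i:{..<n}. {..<d i}) y"
        using qe_translate[of k y "- x"] lincomb_qe[of "\<lambda>i. {..<d i}" "\<lambda>ia. v ia x" p] by (simp add: k(1))
      also have "\<dots> = 0" by (simp only: lincomb_def v diff_self)
      finally show ?thesis .
    qed
    from qe_eq_0[OF this i] show ?thesis by simp
  qed
  show ?thesis
    using a
  proof (induction "d i - degree (p i a)" arbitrary: a rule: less_induct)
    case less
    let ?r = "degree (p i a)"
    have r: "?r < d i" using bij[OF i] less.prems by (auto simp: bij_betw_def)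
    then have k': "k i \<noteq> 0" "degree (k i) = d i - 1" using k(2)[OF i] by auto
    obtain c where c: "\<And>x. coeff (k i \<circ>\<^sub>p [:- x, 1:]) ?r = poly c x" "deg_below (Suc (d i - 1 - ?r)) c"
      "coeff c (d i - 1 - ?r) = lead_coeff (k i) * of_nat ((d i - 1) choose ?r) * (- 1) ^ (d i - 1 - ?r)"
      using ex_coeff_translate[of "k i" ?r] r unfolding k'(2) by auto
    \<comment> \<open>Besides \<open>a\<close>, only members of degree above \<open>?r\<close>
      contribute to the coefficient of \<open>y ^ ?r\<close>. Their duals are known by the
      induction, which descends in degree.\<close>
    define B where "B = {b \<in> {..<d i}. ?r < degree (p i b)}"
    have "\<exists>w. w \<noteq> 0 \<and> degree w = d i - Suc (degree (p i b)) \<and>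
        (\<forall>x. v (i, b) x = cpow L (alpha i) (- x) * poly w x)" if "b \<in> B" for b
      using less.hyps[of b] that r unfolding B_def by auto
    then obtain w where w: "\<And>b. b \<in> B \<Longrightarrow> degree (w b) = d i - Suc (degree (p i b))"
      "\<And>b x. b \<in> B \<Longrightarrow> v (i, b) x = cpow L (alpha i) (- x) * poly (w b) x"
      by metis
    define s where "s = (\<Sum>b\<in>B. smult (coeff (p i b) ?r) (w b))"
    define w' where "w' = smult (1 / lead_coeff (p i a)) (c - s)"
    have lead: "lead_coeff (p i a) \<noteq> 0" using nz[OF i less.prems] by simp
    have "v (i, a) x = cpow L (alpha i) (- x) * poly w' x" for x
    proof -
      have "cpow L (alpha i) (- x) * poly c x = (\<Sum>b<d i. v (i, b) x * coeff (p i b) ?r)"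
        using arg_cong[OF eq[of x], of "\<lambda>q. coeff q ?r"] by (simp add: c(1) coeff_sum)
      also have "\<dots> = (\<Sum>b\<in>insert a B. v (i, b) x * coeff (p i b) ?r)"
      proof (rule sum.mono_neutral_right)
        show "\<forall>b\<in>{..<d i} - insert a B. v (i, b) x * coeff (p i b) ?r = 0"
        proof
          fix b assume b: "b \<in> {..<d i} - insert a B"
          then have "degree (p i b) \<noteq> ?r"
            using bij[OF i] less.prems by (auto simp: bij_betw_def dest: inj_onD)
          then have "degree (p i b) < ?r" using b by (auto simp: B_def)
          then show "v (i, b) x * coeff (p i b) ?r = 0" by (simp add: coeff_eq_0)
        qed
      qed (use less.prems in \<open>auto simp: B_def\<close>)
      also have "\<dots> = v (i, a) x * lead_coeff (p i a) + (\<Sum>b\<in>B. v (i, b) x * coeff (p i b) ?r)"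
        by (subst sum.insert) (auto simp: B_def)
      also have "(\<Sum>b\<in>B. v (i, b) x * coeff (p i b) ?r) = cpow L (alpha i) (- x) * poly s x"
        by (simp add: s_def poly_sum w(2) sum_distrib_left algebra_simps)
      finally have "v (i, a) x * lead_coeff (p i a) = cpow L (alpha i) (- x) * (poly c x - poly s x)"
        by (simp add: algebra_simps)
      then show ?thesis using lead by (simp add: w'_def field_simps)
    qed
    \<comment> \<open>Members of \<open>B\<close> have larger degree, so their duals have smaller
      degree and leave the top coefficient of \<open>c\<close> untouched.\<close>
    moreover have s: "deg_below (d i - 1 - ?r) s"
      unfolding deg_below_def s_def coeff_sum
    proof (intro allI impI sum.neutral ballI)
      fix m b assume m: "d i - 1 - ?r \<le> m" and b: "b \<in> B"
      have "degree (p i b) < d i" using bij[OF i] b by (auto simp: B_def bij_betw_def)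
      then have "degree (w b) < m" using w(1)[OF b] b m by (auto simp: B_def)
      then show "coeff (smult (coeff (p i b) ?r) (w b)) m = 0" by (simp add: coeff_eq_0)
    qed
    have top: "coeff w' (d i - 1 - ?r) \<noteq> 0"
    proof -
      have "lead_coeff (k i) \<noteq> 0" "(d i - 1) choose ?r \<noteq> 0" using k'(1) r by simp_all
      then show ?thesis using s c(3) lead by (simp add: w'_def deg_below_def)
    qed
    then have "w' \<noteq> 0" by auto
    moreover have "deg_below (Suc (d i - 1 - ?r)) w'"
      using c(2) s by (simp add: w'_def deg_below_def)
    then have "degree w' = d i - Suc ?r"
      using le_degree[OF top] deg_below_imp_degree_less[OF _ \<open>w' \<noteq> 0\<close>] by fastforce
    ultimately show ?case by blast
  qed
qed

text \<open>
  The matrix \<open>ker (l + j)\<close>, \<open>0 \<le> l, j < D\<close>, is antitriangular, so the dual of a basis adapted to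
  the flag of vanishing orders at \<open>z\<close> is adapted to the opposite flag.
\<close>

lemma dual_family_vanishing_order:
  assumes fin: "finite I" and bij: "bij_betw ord I {..<D}"
    and ord: "\<And>a. a \<in> I \<Longrightarrow> vanishing_order (u a) z (ord a)"
    and v: "\<And>x y. ker (y - x) = (\<Sum>a\<in>I. v a x * u a y)"
    and a: "a \<in> I"
  shows "vanishing_order (\<lambda>x. v a (1 - x)) (1 - z) (D - Suc (ord a))"
proof -
  \<comment> \<open>Evaluate the kernel at \<open>y = z + ord a\<close> and
    \<open>x = z - j\<close>. Members of larger order vanish at \<open>y\<close>; the coefficients
    of those of smaller order vanish at \<open>x\<close> by induction. Only the term of
    \<open>a\<close> remains.\<close>
  have pairing: "v a (z - of_nat j) * u a (z + of_nat (ord a)) = (if Suc (j + ord a) = D then 1 else 0)"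
    if "Suc (j + ord a) \<le> D" for j
    using a that
  proof (induction "ord a" arbitrary: a rule: less_induct)
    case less
    have "ker (of_nat (ord a + j)) = (\<Sum>b\<in>I. v b (z - of_nat j) * u b (z + of_nat (ord a)))"
      using v[of "z + of_nat (ord a)" "z - of_nat j"] by simp
    also have "\<dots> = v a (z - of_nat j) * u a (z + of_nat (ord a)) +
        (\<Sum>b\<in>I - {a}. v b (z - of_nat j) * u b (z + of_nat (ord a)))"
      using fin less.prems(1) by (intro sum.remove) auto
    also have "(\<Sum>b\<in>I - {a}. v b (z - of_nat j) * u b (z + of_nat (ord a))) = 0"
    proof (rule sum.neutral, rule ballI)
      fix b assume b: "b \<in> I - {a}"
      then have "ord b \<noteq> ord a" using bij less.prems(1) by (auto simp: bij_betw_def dest: inj_onD)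
      then consider "ord b < ord a" | "ord a < ord b" by linarith
      then show "v b (z - of_nat j) * u b (z + of_nat (ord a)) = 0"
      proof cases
        case 1
        then have "v b (z - of_nat j) * u b (z + of_nat (ord b)) = 0"
          using less.hyps[OF 1] b less.prems(2) by simp
        then show ?thesis using ord[of b] b by (simp add: vanishing_order_def)
      next
        case 2
        then show ?thesis using ord[of b] b by (simp add: vanishing_order_def)
      qed
    qed
    finally show ?case using ker(2)[of "ord a + j"] less.prems(2) by (simp add: add.commute)
  qed
  have "ord a < D" using bij a by (auto simp: bij_betw_def)
  \<comment> \<open>The reflected function takes this value \<open>v a (z - j)\<close> at
    \<open>(1 - z) + j\<close>.\<close>
  then have "v a (z - of_nat j) = 0 \<longleftrightarrow> j \<noteq> D - Suc (ord a)" if "j \<le> D - Suc (ord a)" for j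
  proof -
    have "Suc (j + ord a) \<le> D" "Suc (j + ord a) = D \<longleftrightarrow> j = D - Suc (ord a)"
      using that \<open>ord a < D\<close> by linarith+
    then have "v a (z - of_nat j) * u a (z + of_nat (ord a)) = (if j = D - Suc (ord a) then 1 else 0)"
      using pairing[of j] by simp
    moreover have "u a (z + of_nat (ord a)) \<noteq> 0" using ord[OF a] by (simp add: vanishing_order_def)
    ultimately show ?thesis by (auto split: if_splits)
  qed
  then show ?thesis by (simp add: vanishing_order_def)
qed

text \<open>The basis \<open>psi\<close> is completed to a basis of \<open>H\<close> whose orders at
  \<open>z\<close> fill \<open>{..<D}\<close>. The duals of the added members form a basis of the
  reflected annihilator, with the complementary orders.\<close>

lemma dual_exponents:
  assumes psi: "is_basis psi W" "length psi = N" and WH: "W \<subseteq> H" and D: "D = N + M"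
    and la: "is_partition la" "la N = 0"
    and ord: "\<And>a. a < N \<Longrightarrow> vanishing_order (psi ! a) z (N + la a - Suc a)"
  shows "la 0 \<le> M" and "has_discrete_exponents ((\<lambda>f x. f (- x)) ` annihilator W) (1 - z)
    (map (\<lambda>i. M + conj_part la i - Suc i) [0..<M])"
proof -
  have psi_H: "psi ! a \<in> H" if "a < N" for a
  proof -
    have "psi ! a \<in> cfun.span (set psi)" using psi(2) that by (intro cfun.span_base) simp
    then show ?thesis using psi(1) WH by (auto simp: is_basis_def)
  qed
  \<comment> \<open>A larger first part would give \<open>psi ! 0\<close> at least \<open>D\<close>
    consecutive zeros. For \<open>N = 0\<close> the hypothesis \<open>la N = 0\<close> gives the
    claim.\<close>
  show M: "la 0 \<le> M"
  proof (cases "N = 0")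
    case True
    then show ?thesis using la by simp
  next
    case False
    show ?thesis
    proof (rule ccontr)
      assume "\<not> la 0 \<le> M"
      then have "psi ! 0 = (\<lambda>_. 0)"
        using ord[of 0] False D by (intro H_vanishing[OF psi_H, of 0 z]) (auto simp: vanishing_order_def)
      then show False using ord[of 0] False by (simp add: vanishing_order_def)
    qed
  qed
  let ?e = "boundary_pos N la"
  have bij: "bij_betw ?e {..<D} {..<D}"
    unfolding D by (rule bij_betw_boundary_pos[OF la M])
  \<comment> \<open>Since \<open>ker\<close> vanishes at \<open>0, ..., D - 2\<close> and not at
    \<open>D - 1\<close>, its translate by \<open>z - (D - 1 - e)\<close> has order \<open>e\<close>
    at \<open>z\<close>. This supplies the missing orders.\<close>
  define u where "u a = (if a < N then psi ! a else (\<lambda>y. ker (y - (z - of_nat (D - Suc (?e a))))))" for a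
  have u_ord: "vanishing_order (u a) z (?e a)" if "a \<in> {..<D}" for a
  proof (cases "a < N")
    case True
    then show ?thesis using ord by (simp add: u_def boundary_pos_def)
  next
    case False
    have e: "?e a < D" using bij that by (auto simp: bij_betw_def)
    have "u a (z + of_nat l) = (if l = ?e a then 1 else 0)" if "l \<le> ?e a" for l
    proof -
      have "u a (z + of_nat l) = ker (of_nat (l + (D - Suc (?e a))))"
        using False by (simp add: u_def)
      also have "\<dots> = (if Suc (l + (D - Suc (?e a))) = D then 1 else 0)"
        by (rule ker(2)) (use e that in linarith)
      finally show ?thesis using e that by auto
    qed
    then show ?thesis by (simp add: vanishing_order_def)
  qed
  have ind: "indep_fam u {..<D}"
    by (rule indep_fam_vanishing_order[OF _ _ u_ord]) (use bij in \<open>auto simp: bij_betw_def\<close>)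
  have "u ` {..<D} \<subseteq> H"
    using psi_H ker_translate by (auto simp: u_def)
  then have "cfun.span (u ` {..<D}) = H"
    by (intro span_eq_H ind) auto
  then obtain v where v: "\<And>x y. ker (y - x) = (\<Sum>a<D. v a x * u a y)"
    using ex_dual_family[of "{..<D}" u] by auto
  have un: "{..<N} \<union> {N..<D} = {..<D}" using D by auto
  have "annihilator W = cfun.span ((\<lambda>a x. v a (x + 1)) ` {N..<D})"
  proof (rule annihilator_eq_span)
    have "u ` {..<N} = (!) psi ` {..<N}" by (rule image_cong) (auto simp: u_def)
    then show "cfun.span (u ` {..<N}) = W" using psi by (simp add: is_basis_nth)
  qed (use v ind in \<open>auto simp: un\<close>)
  then have T: "(\<lambda>f x. f (- x)) ` annihilator W = cfun.span ((\<lambda>a x. v a (1 - x)) ` {N..<D})"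
    by (simp add: reflect_span)
  define g where "g = (\<lambda>j x. v (N + j) (1 - x))"
  have shift: "{N..<D} = (\<lambda>j. N + j) ` set [0..<M]" using image_add_atLeastLessThan[of N 0 M] D by (simp add: add.commute)
  then have T': "(\<lambda>f x. f (- x)) ` annihilator W = cfun.span (g ` set [0..<M])"
    by (simp only: T shift image_image g_def)
  have g_ord: "vanishing_order (g j) (1 - z) (M + conj_part la j - Suc j)" if "j < M" for j
  proof -
    have "vanishing_order (g j) (1 - z) (D - Suc (?e (N + j)))"
      unfolding g_def by (rule dual_family_vanishing_order[OF _ bij u_ord v]) (use that D in auto)
    then show ?thesis using boundary_pos_dual[OF la M that] by (simp add: D)
  qed
  have less: "M + conj_part la b - Suc b < M + conj_part la a - Suc a" if "a < b" "b < M" for a b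
    using partition_exponents_less[OF is_partition_conj_part[OF la(1)]] that .
  have "indep_fam g (set [0..<M])"
  proof (rule indep_fam_vanishing_order)
    show "inj_on (\<lambda>j. M + conj_part la j - Suc j) (set [0..<M])"
      using less by (intro linorder_inj_onI) fastforce+
  qed (use g_ord in auto)
  then have "is_basis (map g [0..<M]) ((\<lambda>f x. f (- x)) ` annihilator W)"
    by (simp add: is_basis_map T' del: set_upt)
  then show "has_discrete_exponents ((\<lambda>f x. f (- x)) ` annihilator W) (1 - z)
      (map (\<lambda>i. M + conj_part la i - Suc i) [0..<M])"
    unfolding has_discrete_exponents_iff
    using g_ord less by (intro conjI exI[of _ "map g [0..<M]"]) (auto simp: sorted_wrt_iff_nth_less)
qed

end

section \<open>Bases of quasi-exponential spaces as indexed families\<close>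

lemma qe_spaces_iff:
  "W \<in> qe_spaces L n alpha mu \<longleftrightarrow>
    (\<exists>q. (\<forall>i<n. \<forall>j<conj_part (mu i) 0. degree (q i j) = conj_part (mu i) 0 + mu i j - Suc j) \<and>
      indep_fam (\<lambda>(i, j) x. cpow L (alpha i) x * poly (q i j) x)
        (SIGMA i:{..<n}. {..<conj_part (mu i) 0}) \<and>
      cfun.span ((\<lambda>(i, j) x. cpow L (alpha i) x * poly (q i j) x) `
        (SIGMA i:{..<n}. {..<conj_part (mu i) 0})) = W)"
proof -
  let ?I = "SIGMA i:{..<n}. {..<conj_part (mu i) 0}"
  define xs where "xs = concat (map (\<lambda>i. map (Pair i) [0..<conj_part (mu i) 0]) [0..<n])"
  have set_xs: "set xs = ?I" by (auto simp: xs_def)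
  have "length xs = card ?I"
    by (simp add: xs_def length_concat comp_def interv_sum_list_conv_sum_set_nat atLeast0LessThan)
  then have "distinct xs" using set_xs card_distinct by metis
  moreover have "[\<lambda>x. cpow L (alpha i) x * poly (q i j) x. i \<leftarrow> [0..<n], j \<leftarrow> [0..<conj_part (mu i) 0]] =
      map (\<lambda>(i, j) x. cpow L (alpha i) x * poly (q i j) x) xs" for q
    by (simp add: xs_def map_concat comp_def)
  ultimately show ?thesis by (simp add: qe_spaces_def is_basis_map set_xs)
qed

section \<open>The duality map\<close>

context quasi_exponentials
begin

lemma W_hat_eq_H:
  assumes "\<And>i. i < n \<Longrightarrow> d i = mu i 0 + conj_part (mu i) 0"
  shows "W_hat L n alpha mu = H"
proof -
  have "{\<lambda>x. cpow L (alpha i) x * x ^ p | i p. i < n \<and> p < mu i 0 + conj_part (mu i) 0} =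
      qe_monom ` (SIGMA i:{..<n}. {..<d i})"
    using assms by (force simp: qe_monom_def poly_monom image_iff)
  then show ?thesis by (simp add: W_hat_def H_eq_span)
qed

text \<open>One admissible choice is given, and every admissible choice yields the annihilator, so
  the definite description is well defined.\<close>

lemma Q_space_eq_annihilator:
  assumes "is_basis fs W" "is_basis (fs @ hs) H" "W_hat L n alpha mu = H"
  shows "Q_space L n alpha mu W = annihilator W"
  unfolding Q_space_def assms(3)
proof (rule the_equality)
  show "\<exists>fs hs. is_basis fs W \<and> is_basis (fs @ hs) H \<and>
      annihilator W = cfun.span (phi_fun fs hs ` {..<length hs})"
    using assms span_phi_fun by metis
qed (use span_phi_fun in metis)

text \<open>
  The basis of \<open>H\<close> adapted to \<open>W\<close> consists of the given basis of \<open>W\<close> and monomials of the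
  missing degrees.
\<close>

lemma dual_qe_space:
  assumes mu: "\<And>i. i < n \<Longrightarrow> is_partition (mu i)"
    and d: "\<And>i. i < n \<Longrightarrow> d i = mu i 0 + conj_part (mu i) 0"
    and W: "W \<in> qe_spaces L n alpha mu"
  shows "W \<subseteq> H" and "frakT1 L n alpha mu W = (\<lambda>f x. f (- x)) ` annihilator W"
    and "frakT1 L n alpha mu W \<in> qe_spaces L n alpha (\<lambda>i. conj_part (mu i))"
proof -
  define N where "N i = conj_part (mu i) 0" for i
  define M where "M i = mu i 0" for i
  have dN: "d i = N i + M i" if "i < n" for i using d[OF that] by (simp add: N_def M_def)
  have muN: "mu i (N i) = 0" if "i < n" for i
    using conj_part_le_iff[OF mu[OF that], of 0 "N i"] by (simp add: N_def)
  obtain q where q: "\<And>i j. i < n \<Longrightarrow> j < N i \<Longrightarrow> degree (q i j) = N i + mu i j - Suc j"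
    "indep_fam (\<lambda>(i, j) x. cpow L (alpha i) x * poly (q i j) x) (SIGMA i:{..<n}. {..<N i})"
    "cfun.span ((\<lambda>(i, j) x. cpow L (alpha i) x * poly (q i j) x) ` (SIGMA i:{..<n}. {..<N i})) = W"
    using W unfolding qe_spaces_iff N_def by blast
  define e where "e i = boundary_pos (N i) (mu i)" for i
  have bij: "bij_betw (e i) {..<d i} {..<d i}" if "i < n" for i
    unfolding e_def dN[OF that] using that mu muN by (intro bij_betw_boundary_pos) (auto simp: M_def)
  \<comment> \<open>The degrees of \<open>q i\<close> are the vertical boundary positions; monomials
    fill the horizontal ones.\<close>
  define p where "p i a = (if a < N i then q i a else monom 1 (e i a))" for i a
  define u where "u = (\<lambda>(i, a) x. cpow L (alpha i) x * poly (p i a) x)"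
  define J1 where "J1 = (SIGMA i:{..<n}. {..<N i})"
  define J2 where "J2 = (SIGMA i:{..<n}. {N i..<d i})"
  have fin: "finite J1" "finite J2" by (auto simp: J1_def J2_def)
  have J: "J1 \<union> J2 = (SIGMA i:{..<n}. {..<d i})" "J1 \<inter> J2 = {}"
    using dN by (fastforce simp: J1_def J2_def)+
  have u_J1: "u a = (\<lambda>(i, j) x. cpow L (alpha i) x * poly (q i j) x) a" if "a \<in> J1" for a
    using that by (auto simp: u_def J1_def p_def)
  have deg: "degree (p i a) = e i a" if "i < n" "a < d i" for i a
    using that q(1) by (auto simp: p_def e_def boundary_pos_def degree_monom_eq)
  have nz: "p i a \<noteq> 0" if "i < n" "a < d i" for i a
  proof (cases "a < N i")
    case True
    then have "(\<lambda>(i, j) x. cpow L (alpha i) x * poly (q i j) x) (i, a) \<noteq> (\<lambda>_. 0)"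
      using that by (intro indep_fam_nonzero[OF _ q(2)]) auto
    then show ?thesis using True by (auto simp: p_def)
  qed (simp add: p_def monom_eq_0_iff)
  have bij': "bij_betw (\<lambda>a. degree (p i a)) {..<d i} {..<d i}" if "i < n" for i
    using bij[OF that] by (subst bij_betw_cong[where g = "e i"]) (auto simp: deg that)
  have ind: "indep_fam u (J1 \<union> J2)"
    unfolding J u_def using bij' nz by (intro indep_fam_qe) (auto simp: bij_betw_def)
  have uH: "u a \<in> H" if a: "a \<in> J1 \<union> J2" for a
  proof -
    obtain i b where [simp]: "a = (i, b)" "i < n" "b < d i" using a J by auto
    have "u a = qe (\<lambda>j. if j = i then p i b else 0)"
      by (simp add: u_def qe_def fun_eq_iff if_distrib[of "\<lambda>q. poly q _"] if_distrib[of "\<lambda>c. _ * c"] cong: if_cong)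
    moreover have "deg_below (d i) (p i b)"
      using bij'[of i] by (intro deg_below_degree) (auto simp: bij_betw_def)
    then have "\<forall>j<n. deg_below (d j) (if j = i then p i b else 0)" by (simp add: deg_below_def)
    ultimately show ?thesis unfolding H_def by blast
  qed
  have spanH: "cfun.span (u ` (J1 \<union> J2)) = H"
    by (rule span_eq_H) (use fin ind uH J card_monomials in auto)
  have spanW: "cfun.span (u ` J1) = W"
    using q(3) u_J1 unfolding J1_def by (metis (no_types, lifting) image_cong)
  show "W \<subseteq> H"
    unfolding spanW[symmetric] by (intro cfun.span_minimal subspace_H image_subsetI uH) simp
  obtain xs ys where xs: "set xs = J1" "distinct xs" and ys: "set ys = J2" "distinct ys"
    using fin finite_distinct_list by metis
  have "indep_fam u J1"
    using ind fin cfun.independent_mono[of "u ` (J1 \<union> J2)" "u ` J1"]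
    by (auto simp: indep_fam_iff inj_on_Un)
  then have "is_basis (map u xs) W" using spanW xs by (simp add: is_basis_map)
  moreover have "is_basis (map u xs @ map u ys) H"
    using is_basis_map[of "xs @ ys" u H] xs ys J(2) ind spanH by simp
  ultimately have "Q_space L n alpha mu W = annihilator W"
    using W_hat_eq_H[OF d] by (rule Q_space_eq_annihilator)
  then show T: "frakT1 L n alpha mu W = (\<lambda>f x. f (- x)) ` annihilator W"
    by (simp add: frakT1_def)
  obtain v where v: "\<And>x y. ker (y - x) = (\<Sum>a\<in>J1 \<union> J2. v a x * u a y)"
    using ex_dual_family[OF _ spanH] fin by auto
  have "annihilator W = cfun.span ((\<lambda>a x. v a (x + 1)) ` J2)"
    by (rule annihilator_eq_span[OF fin J(2) ind spanW v])
  then have T': "frakT1 L n alpha mu W = cfun.span ((\<lambda>a x. v a (1 - x)) ` J2)"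
    by (simp add: T reflect_span fin)
  have "\<exists>w. w \<noteq> 0 \<and> degree w = d i - Suc (degree (p i a)) \<and>
      (\<forall>x. v (i, a) x = cpow L (alpha i) (- x) * poly w x)" if "i < n" "a < d i" for i a
    by (rule dual_family_qe[OF bij' nz _ that]) (use v in \<open>auto simp: J u_def\<close>)
  then obtain w where w: "\<And>i a. i < n \<Longrightarrow> a < d i \<Longrightarrow> w i a \<noteq> 0"
    "\<And>i a. i < n \<Longrightarrow> a < d i \<Longrightarrow> degree (w i a) = d i - Suc (e i a)"
    "\<And>i a x. i < n \<Longrightarrow> a < d i \<Longrightarrow> v (i, a) x = cpow L (alpha i) (- x) * poly (w i a) x"
    by (metis deg)
  \<comment> \<open>From \<open>v (i, a) (1 - x)\<close> the exponential contributes
    \<open>alpha ^ (x - 1)\<close>: the constant \<open>alpha ^ (- 1)\<close> joins the polynomial,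
    which is composed with \<open>1 - x\<close>.\<close>
  define r where "r i j = smult (cpow L (alpha i) (- 1)) (w i (N i + j) \<circ>\<^sub>p [:1, - 1:])" for i j
  define g where "g = (\<lambda>(i, j) x. cpow L (alpha i) x * poly (r i j) x)"
  have lt: "N i + j < d i" if "i < n" "j < M i" for i j using dN that by simp
  have g: "g (i, j) = (\<lambda>x. v (i, N i + j) (1 - x))" if "i < n" "j < M i" for i j
  proof
    fix x
    have "v (i, N i + j) (1 - x) = cpow L (alpha i) (x + (- 1)) * poly (w i (N i + j)) (1 - x)"
      using w(3)[OF that(1) lt[OF that], of "1 - x"] by simp
    then show "g (i, j) x = v (i, N i + j) (1 - x)"
      by (simp only: cpow_add) (simp add: g_def r_def poly_pcompose)
  qed
  have deg_r: "degree (r i j) = M i + conj_part (mu i) j - Suc j" if "i < n" "j < M i" for i j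
  proof -
    have "degree (r i j) = N i + M i - Suc (boundary_pos (N i) (mu i) (N i + j))"
      using w(2)[OF that(1) lt[OF that]] dN[OF that(1)]
      by (simp add: r_def degree_pcompose cpow_nonzero e_def)
    then show ?thesis using boundary_pos_dual[OF mu muN _ that(2)] that by (simp add: M_def)
  qed
  have r_nz: "r i j \<noteq> 0" if "i < n" "j < M i" for i j
    using w(1)[OF that(1) lt[OF that]] by (auto simp: r_def cpow_nonzero pcompose_eq_0_iff)
  have "J2 = (\<lambda>(i, j). (i, N i + j)) ` (SIGMA i:{..<n}. {..<M i})"
  proof (intro equalityI subsetI)
    fix a assume "a \<in> J2"
    then show "a \<in> (\<lambda>(i, j). (i, N i + j)) ` (SIGMA i:{..<n}. {..<M i})"
      using dN by (intro image_eqI[of _ _ "(fst a, snd a - N (fst a))"]) (auto simp: J2_def)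
  qed (use lt in \<open>auto simp: J2_def\<close>)
  then have "(\<lambda>a x. v a (1 - x)) ` J2 = g ` (SIGMA i:{..<n}. {..<M i})"
    using g by (auto simp: image_image intro!: image_cong)
  then have span_g: "cfun.span (g ` (SIGMA i:{..<n}. {..<M i})) = frakT1 L n alpha mu W"
    by (simp add: T')
  have ind_g: "indep_fam g (SIGMA i:{..<n}. {..<M i})"
    unfolding g_def
  proof (rule indep_fam_qe)
    fix i assume i: "i < n"
    have "degree (r i b) < degree (r i a)" if "a < b" "b < M i" for a b
      using partition_exponents_less[OF is_partition_conj_part[OF mu[OF i]] that] deg_r[OF i] that by simp
    then show "inj_on (\<lambda>a. degree (r i a)) {..<M i}"
      by (intro linorder_inj_onI) fastforce+
  qed (use r_nz in auto)
  have MM: "conj_part (conj_part (mu i)) 0 = M i" if "i < n" for i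
    using conj_part_conj_part[OF mu[OF that]] by (simp add: M_def)
  then have Sig: "(SIGMA i:{..<n}. {..<conj_part (conj_part (mu i)) 0}) = (SIGMA i:{..<n}. {..<M i})"
    by (intro Sigma_cong) auto
  show "frakT1 L n alpha mu W \<in> qe_spaces L n alpha (\<lambda>i. conj_part (mu i))"
    unfolding qe_spaces_iff Sig using ind_g span_g deg_r MM by (intro exI[of _ r]) (auto simp: g_def)
qed

end

section \<open>Conjugate difference data of the dual space\<close>

theorem theorem2p16:
  fixes L :: "complex \<Rightarrow> complex"
    and n k :: nat
    and alpha z :: "nat \<Rightarrow> complex"
    and mu la :: "nat \<Rightarrow> nat \<Rightarrow> nat"
    and W :: "(complex \<Rightarrow> complex) set"
  assumes "is_ln_branch L"
    and "has_difference_data L n alpha mu k z la W"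
  shows "has_difference_data L n alpha (\<lambda>i. conj_part (mu i)) k (\<lambda>a. 1 - z a)
           (\<lambda>a. conj_part (la a)) (frakT1 L n alpha mu W)"
proof -
  define N where "N = (\<Sum>i<n. conj_part (mu i) 0)"
  define M where "M = (\<Sum>i<n. mu i 0)"
  have adm: "admissible_data n alpha mu k z la" and W: "W \<in> qe_spaces L n alpha mu"
    and exps: "\<And>a. a < k \<Longrightarrow> discrete_singular_point W (z a)"
      "\<And>a. a < k \<Longrightarrow> has_discrete_exponents W (z a) (map (\<lambda>i. N + la a i - Suc i) [0..<N])"
      "\<And>a i. a < k \<Longrightarrow> N \<le> i \<Longrightarrow> la a i = 0"
    and sizes: "(\<Sum>a<k. part_size (la a)) = (\<Sum>i<n. part_size (mu i))"
    using assms(2) by (auto simp: has_difference_data_def Let_def N_def)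
  have mu: "is_partition (mu i)" "\<exists>j. mu i j \<noteq> 0" if "i < n" for i
    using adm that by (auto simp: admissible_data_def)
  have la: "is_partition (la a)" if "a < k" for a
    using adm that by (auto simp: admissible_data_def)
  interpret quasi_exponentials L n alpha "\<lambda>i. mu i 0 + conj_part (mu i) 0"
    by unfold_locales (use assms(1) adm in \<open>auto simp: admissible_data_def\<close>)
  have dual: "W \<subseteq> H" "frakT1 L n alpha mu W = (\<lambda>f x. f (- x)) ` annihilator W"
    "frakT1 L n alpha mu W \<in> qe_spaces L n alpha (\<lambda>i. conj_part (mu i))"
    using dual_qe_space[of mu W] mu(1) W by blast+
  \<comment> \<open>The dimension of \<open>W\<close> and that of its dual add up to the dimension
    of \<open>H\<close>.\<close>
  have D: "D = N + M" by (simp add: D_def N_def M_def sum.distrib)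
  have M': "(\<Sum>i<n. conj_part (conj_part (mu i)) 0) = M"
    unfolding M_def by (rule sum.cong) (simp_all add: conj_part_conj_part mu)
  have dual_exps: "discrete_singular_point (frakT1 L n alpha mu W) (1 - z a)"
    "has_discrete_exponents (frakT1 L n alpha mu W) (1 - z a)
      (map (\<lambda>i. M + conj_part (la a) i - Suc i) [0..<M])"
    "\<And>i. M \<le> i \<Longrightarrow> conj_part (la a) i = 0" if a: "a < k" for a
  proof -
    have laN: "la a N = 0" using exps(3)[OF a] by simp
    obtain psi where psi: "is_basis psi W" "length psi = N"
      "\<And>i. i < N \<Longrightarrow> vanishing_order (psi ! i) (z a) (N + la a i - Suc i)"
      using exps(2)[OF a] by (auto simp: has_discrete_exponents_iff)
    note * = dual_exponents[OF psi(1,2) dual(1) D la[OF a] laN psi(3)]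
    show exps': "has_discrete_exponents (frakT1 L n alpha mu W) (1 - z a)
        (map (\<lambda>i. M + conj_part (la a) i - Suc i) [0..<M])"
      unfolding dual(2) by (rule *(2))
    show zero: "conj_part (la a) i = 0" if "M \<le> i" for i
      using conj_part_le_iff[OF la[OF a], of i 0] *(1) that by simp
    \<comment> \<open>Singularity means that the partition is nonzero, a property shared by its
      conjugate.\<close>
    have "la a 0 \<noteq> 0"
      using discrete_singular_point_iff[OF la[OF a] exps(2)[OF a] laN] exps(1)[OF a] by simp
    then have "conj_part (la a) 0 \<noteq> 0" using less_conj_part_iff[OF la[OF a], of 0 0] by simp
    then show "discrete_singular_point (frakT1 L n alpha mu W) (1 - z a)"
      using discrete_singular_point_iff[OF is_partition_conj_part[OF la[OF a]] exps' zero[OF order_refl]]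
      by simp
  qed
  have "admissible_data n alpha (\<lambda>i. conj_part (mu i)) k (\<lambda>a. 1 - z a) (\<lambda>a. conj_part (la a))"
    unfolding admissible_data_def
  proof (intro conjI allI impI)
    fix i assume i: "i < n"
    obtain j where "0 < mu i j" using mu(2)[OF i] by auto
    then have "j < conj_part (mu i) 0" using less_conj_part_iff[OF mu(1)[OF i]] by simp
    then show "\<exists>j. conj_part (mu i) j \<noteq> 0" by (intro exI[of _ 0]) simp
  next
    fix a b assume "a < k" "b < k" "a \<noteq> b"
    then have "z b - z a \<notin> \<int>" using adm by (auto simp: admissible_data_def)
    then show "1 - z a - (1 - z b) \<notin> \<int>" by (simp add: algebra_simps)
  qed (use adm in \<open>auto simp: admissible_data_def is_partition_conj_part\<close>)
  moreover have "(\<Sum>a<k. part_size (conj_part (la a))) = (\<Sum>i<n. part_size (conj_part (mu i)))"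
    using sizes by (simp add: part_size_conj_part la mu)
  ultimately show ?thesis
    unfolding has_difference_data_def Let_def M' using dual(3) dual_exps by blast
qed

end
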